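(* There exists an essential, natural, regular uniform algebra on the closed unit disc $\overline{\mathbb D}=\{z\in\mathbb C: |z|\le 1\}$.
   Context: For a compact Hausdorff space $X$, $C(X)$ is the algebra of all continuous complex-valued functions on $X$ with the supremum norm. A uniform algebra on $X$ is a closed subalgebra of $C(X)$ that contains the constant functions and separates the points of $X$. Let $A$ be a uniform algebra on $X$. The essential set for $A$ is the smallest closed subset $E$ of $X$ such that $A$ contains every continuous function on $X$ that vanishes on $E$; $A$ is essential if its essential set is $X$. $A$ is natural (on $X$) if the only non-zero multiplicative linear functionals on $A$ are the evaluations at the points of $X$. $A$ is regular on $X$ if, for each closed subset $E\subseteq X$ and each $x\in X\setminus E$, there is $f\in A$ with $f(x)=1$ and $f(E)\subseteq\{0\}$; $A$ is regular if it is natural and regular on $X$. *)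

theory Defs
  imports "HOL-Analysis.Analysis"
begin

text \<open>
  For compact \<open>X\<close> the bound imposed by \<^const>\<open>cfunspace\<close> is automatic
  (\<open>compactin_mspace_cfunspace\<close>), and its metric is the one induced by the supremum norm.
  Its elements are extensional, i.e. \<open>undefined\<close> outside \<open>topspace X\<close>, so that functions
  on \<open>X\<close> are represented uniquely; the pointwise operations are therefore restricted to
  \<open>topspace X\<close> below.
\<close>

abbreviation CX_metric :: "'a topology \<Rightarrow> ('a \<Rightarrow> complex) metric" where
  "CX_metric X \<equiv> cfunspace X euclidean_metric"

abbreviation CX :: "'a topology \<Rightarrow> ('a \<Rightarrow> complex) set" where
  "CX X \<equiv> mspace (CX_metric X)"

definition fun_add :: "'a topology \<Rightarrow> ('a \<Rightarrow> complex) \<Rightarrow> ('a \<Rightarrow> complex) \<Rightarrow> 'a \<Rightarrow> complex" where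
  "fun_add X f g = (\<lambda>x\<in>topspace X. f x + g x)"

definition fun_mult :: "'a topology \<Rightarrow> ('a \<Rightarrow> complex) \<Rightarrow> ('a \<Rightarrow> complex) \<Rightarrow> 'a \<Rightarrow> complex" where
  "fun_mult X f g = (\<lambda>x\<in>topspace X. f x * g x)"

definition fun_scale :: "'a topology \<Rightarrow> complex \<Rightarrow> ('a \<Rightarrow> complex) \<Rightarrow> 'a \<Rightarrow> complex" where
  "fun_scale X c f = (\<lambda>x\<in>topspace X. c * f x)"

definition fun_const :: "'a topology \<Rightarrow> complex \<Rightarrow> 'a \<Rightarrow> complex" where
  "fun_const X c = (\<lambda>x\<in>topspace X. c)"

definition uniform_algebra :: "'a topology \<Rightarrow> ('a \<Rightarrow> complex) set \<Rightarrow> bool" where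
  "uniform_algebra X A \<longleftrightarrow>
     compact_space X \<and> Hausdorff_space X \<and>
     A \<subseteq> CX X \<and>
     (\<forall>f\<in>A. \<forall>g\<in>A. fun_add X f g \<in> A) \<and>
     (\<forall>f\<in>A. \<forall>g\<in>A. fun_mult X f g \<in> A) \<and>
     (\<forall>c. \<forall>f\<in>A. fun_scale X c f \<in> A) \<and>
     closedin (mtopology_of (CX_metric X)) A \<and>
     (\<forall>c. fun_const X c \<in> A) \<and>
     (\<forall>x\<in>topspace X. \<forall>y\<in>topspace X. x \<noteq> y \<longrightarrow> (\<exists>f\<in>A. f x \<noteq> f y))"

definition contains_vanishing_on ::
    "'a topology \<Rightarrow> ('a \<Rightarrow> complex) set \<Rightarrow> 'a set \<Rightarrow> bool" where
  "contains_vanishing_on X A E \<longleftrightarrow> (\<forall>f\<in>CX X. (\<forall>x\<in>E. f x = 0) \<longrightarrow> f \<in> A)"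

definition is_essential_set ::
    "'a topology \<Rightarrow> ('a \<Rightarrow> complex) set \<Rightarrow> 'a set \<Rightarrow> bool" where
  "is_essential_set X A E \<longleftrightarrow>
     closedin X E \<and> contains_vanishing_on X A E \<and>
     (\<forall>F. closedin X F \<and> contains_vanishing_on X A F \<longrightarrow> E \<subseteq> F)"

definition essential_algebra :: "'a topology \<Rightarrow> ('a \<Rightarrow> complex) set \<Rightarrow> bool" where
  "essential_algebra X A \<longleftrightarrow> is_essential_set X A (topspace X)"

text \<open>
  A functional on \<open>A\<close> is represented by a total function of which only the values on \<open>A\<close> matter.
\<close>

definition mult_linear_functional ::
    "'a topology \<Rightarrow> ('a \<Rightarrow> complex) set \<Rightarrow> (('a \<Rightarrow> complex) \<Rightarrow> complex) \<Rightarrow> bool" where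
  "mult_linear_functional X A \<phi> \<longleftrightarrow>
     (\<forall>f\<in>A. \<forall>g\<in>A. \<phi> (fun_add X f g) = \<phi> f + \<phi> g) \<and>
     (\<forall>c. \<forall>f\<in>A. \<phi> (fun_scale X c f) = c * \<phi> f) \<and>
     (\<forall>f\<in>A. \<forall>g\<in>A. \<phi> (fun_mult X f g) = \<phi> f * \<phi> g)"

definition natural_algebra :: "'a topology \<Rightarrow> ('a \<Rightarrow> complex) set \<Rightarrow> bool" where
  "natural_algebra X A \<longleftrightarrow>
     (\<forall>\<phi>. mult_linear_functional X A \<phi> \<and> (\<exists>f\<in>A. \<phi> f \<noteq> 0) \<longrightarrow>
          (\<exists>x\<in>topspace X. \<forall>f\<in>A. \<phi> f = f x))"

definition regular_on :: "'a topology \<Rightarrow> ('a \<Rightarrow> complex) set \<Rightarrow> bool" where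
  "regular_on X A \<longleftrightarrow>
     (\<forall>E x. closedin X E \<and> x \<in> topspace X - E \<longrightarrow>
            (\<exists>f\<in>A. f x = 1 \<and> f ` E \<subseteq> {0}))"

definition regular_algebra :: "'a topology \<Rightarrow> ('a \<Rightarrow> complex) set \<Rightarrow> bool" where
  "regular_algebra X A \<longleftrightarrow> natural_algebra X A \<and> regular_on X A"

end

theory Submission
  imports Defs "HOL-Complex_Analysis.Weierstrass_Factorization"
begin

text \<open>
  This is the construction of Feinstein and Izzo. Start from McKissick's Swiss cheese \<open>K\<close>: a
  nowhere dense compact set such that \<open>R(K)\<close>, the uniform closure of the rational functions
  without poles on \<open>K\<close>, is natural, regular and different from \<open>C(K)\<close>. Place pairwise disjoint
  scaled copies \<open>T n\<close> of \<open>K\<close> in the disc, with diameters tending to \<open>0\<close>, such that every non-empty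
  open set contains one of them, and take the continuous functions whose restriction to each
  \<open>T n\<close> belongs to the copy of \<open>R(K)\<close>. Since any function on one \<open>T n\<close> extends to a continuous
  function that is constant on all the others, non-triviality of \<open>R(K)\<close> makes this algebra
  essential, and regularity carries over. A character restricted to the functions that are
  constant on every \<open>T n\<close> is the evaluation at a point of the quotient space, so the character is
  the evaluation at a point outside all copies or factors through a single copy of \<open>R(K)\<close>.

  Regularity of \<open>R(K)\<close> comes from infinite products of functions \<open>1 / (1 - (z / s) ^ N)\<close>, which are
  close to \<open>1\<close> inside the circle of radius \<open>s\<close> and close to \<open>0\<close> outside (Koerner). For non-triviality,
  \<open>\<integral> f \<partial>\<psi> = 0\<close> for holomorphic \<open>f\<close>, where \<open>\<partial>\<close> is the Cauchy--Riemann operator and \<open>\<psi>\<close> is a cutoff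
  that vanishes on the removed discs, while \<open>\<integral> cnj z \<partial>\<psi>\<close> stays away from \<open>0\<close> and \<open>\<integral> \<bar>\<partial>\<psi>\<bar>\<close> is
  controlled by the sum of the radii.
\<close>

section \<open>Function algebras and their characters\<close>

text \<open>Elements of \<open>S\<close> are total functions, but only their values on
  \<open>K\<close> count: \<open>lim\<close> applied with exact agreement on \<open>K\<close> makes
  \<open>S\<close> insensitive to changes off \<open>K\<close> (\<open>cong_on\<close>). Restriction
  operators are thereby avoided until the final algebra is formed.\<close>

locale function_algebra =
  fixes K :: "'a set" and S :: "('a \<Rightarrow> complex) set"
  assumes const: "(\<lambda>_. c) \<in> S"
    and add: "\<lbrakk>f \<in> S; g \<in> S\<rbrakk> \<Longrightarrow> (\<lambda>x. f x + g x) \<in> S"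
    and mult: "\<lbrakk>f \<in> S; g \<in> S\<rbrakk> \<Longrightarrow> (\<lambda>x. f x * g x) \<in> S"
    and lim: "(\<And>e. 0 < e \<Longrightarrow> \<exists>g\<in>S. \<forall>x\<in>K. norm (f x - g x) < e) \<Longrightarrow> f \<in> S"
begin

lemma cong_on: "\<lbrakk>f \<in> S; \<And>x. x \<in> K \<Longrightarrow> g x = f x\<rbrakk> \<Longrightarrow> g \<in> S"
  by (rule lim) (auto intro!: bexI[of _ f])

lemma diff: "\<lbrakk>f \<in> S; g \<in> S\<rbrakk> \<Longrightarrow> (\<lambda>x. f x - g x) \<in> S"
  using add[OF _ mult[OF const[of "-1"]], of f g] by simp

lemma power: "f \<in> S \<Longrightarrow> (\<lambda>x. f x ^ n) \<in> S"
  by (induction n) (auto intro: const mult)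

lemma sum: "(\<And>i. i \<in> I \<Longrightarrow> f i \<in> S) \<Longrightarrow> (\<lambda>x. \<Sum>i\<in>I. f i x) \<in> S"
  by (induction I rule: infinite_finite_induct) (auto intro: const add)

text \<open>Neumann series: \<open>f / c\<close> has sup norm below 1 on \<open>K\<close>, so the
  geometric partial sums, which lie in \<open>S\<close>, converge uniformly to
  \<open>1 / (1 - f / c)\<close>.\<close>

lemma resolvent:
  assumes f: "f \<in> S" and M: "\<And>x. x \<in> K \<Longrightarrow> norm (f x) \<le> M" and c: "M < norm c"
  shows "(\<lambda>x. 1 / (f x - c)) \<in> S"
proof (cases "K = {}")
  case True
  then show ?thesis using cong_on[OF f] by auto
next
  case False
  then have "0 \<le> M" using M norm_ge_zero order_trans by blast
  then have c0: "c \<noteq> 0" "0 < norm c" using c by auto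
  define q where "q = M / norm c"
  have q: "0 \<le> q" "q < 1" using \<open>0 \<le> M\<close> c c0 by (auto simp: q_def)
  have fq: "norm (f x / c) \<le> q" if "x \<in> K" for x
    using M[OF that] c0 by (simp add: q_def norm_divide divide_right_mono)
  have "(\<lambda>x. 1 / (1 - f x / c)) \<in> S"
  proof (rule lim)
    fix e :: real assume "0 < e"
    have "(\<lambda>n. q ^ n / (1 - q)) \<longlonglongrightarrow> 0"
      using q by (intro tendsto_eq_intros LIMSEQ_power_zero) auto
    then obtain n where n: "q ^ n / (1 - q) < e"
      using \<open>0 < e\<close> by (meson LIMSEQ_le_const not_less)
    show "\<exists>g\<in>S. \<forall>x\<in>K. norm (1 / (1 - f x / c) - g x) < e"
    proof (intro bexI ballI)
      show "(\<lambda>x. \<Sum>k<n. (f x * (1 / c)) ^ k) \<in> S"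
        by (intro sum power mult f const)
    next
      fix x assume x: "x \<in> K"
      define t where "t = f x / c"
      have t: "norm t \<le> q" using fq[OF x] by (simp add: t_def)
      then have t1: "1 - q \<le> norm (1 - t)"
        using norm_triangle_ineq2[of 1 t] by auto
      then have "1 - t \<noteq> 0" using q by auto
      then have t2: "t \<noteq> 1" by auto
      have "1 / (1 - t) - (\<Sum>k<n. t ^ k) = t ^ n / (1 - t)"
        using t2 by (simp add: sum_gp_strict field_simps)
      then have "norm (1 / (1 - t) - (\<Sum>k<n. t ^ k)) = norm t ^ n / norm (1 - t)"
        by (simp add: norm_divide norm_power)
      also have "\<dots> \<le> q ^ n / (1 - q)"
        using t t1 q by (intro frac_le power_mono) auto
      finally show "norm (1 / (1 - f x / c) - (\<Sum>k<n. (f x * (1 / c)) ^ k)) < e"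
        using n by (simp add: t_def)
    qed
  qed
  from mult[OF const[of "- 1 / c"] this] show ?thesis
  proof (rule cong_on)
    fix x assume x: "x \<in> K"
    have "f x \<noteq> c" using fq[OF x] q c0 by auto
    then show "1 / (f x - c) = - 1 / c * (1 / (1 - f x / c))"
      using c0 by (simp add: field_simps)
  qed
qed

end

text \<open>Characters are normalised by their values on constants; together with multiplicativity
  this contains homogeneity. The last clause says that \<phi> factors through restriction to
  \<open>K\<close>.\<close>

definition character :: "'a set \<Rightarrow> ('a \<Rightarrow> complex) set \<Rightarrow> (('a \<Rightarrow> complex) \<Rightarrow> complex) \<Rightarrow> bool" where
  "character K S \<phi> \<longleftrightarrow>
     (\<forall>f\<in>S. \<forall>g\<in>S. \<phi> (\<lambda>x. f x + g x) = \<phi> f + \<phi> g) \<and>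
     (\<forall>f\<in>S. \<forall>g\<in>S. \<phi> (\<lambda>x. f x * g x) = \<phi> f * \<phi> g) \<and>
     (\<forall>c. \<phi> (\<lambda>_. c) = c) \<and>
     (\<forall>f\<in>S. \<forall>g\<in>S. (\<forall>x\<in>K. f x = g x) \<longrightarrow> \<phi> f = \<phi> g)"

lemma characterD:
  assumes "character K S \<phi>"
  shows "\<lbrakk>f \<in> S; g \<in> S\<rbrakk> \<Longrightarrow> \<phi> (\<lambda>x. f x + g x) = \<phi> f + \<phi> g"
    and "\<lbrakk>f \<in> S; g \<in> S\<rbrakk> \<Longrightarrow> \<phi> (\<lambda>x. f x * g x) = \<phi> f * \<phi> g"
    and "\<phi> (\<lambda>_. c) = c"
    and "\<lbrakk>f \<in> S; g \<in> S; \<And>x. x \<in> K \<Longrightarrow> f x = g x\<rbrakk> \<Longrightarrow> \<phi> f = \<phi> g"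
  using assms unfolding character_def by blast+

lemma (in function_algebra) character_diff:
  assumes \<phi>: "character K S \<phi>" and f: "f \<in> S" "g \<in> S"
  shows "\<phi> (\<lambda>x. f x - g x) = \<phi> f - \<phi> g"
  using characterD(1)[OF \<phi> diff[OF f] f(2)] by simp

text \<open>Characters are contractive: if \<open>\<phi> f\<close> exceeded \<open>M\<close> in
  modulus, then \<open>f - \<phi> f\<close> would be invertible in \<open>S\<close> on
  \<open>K\<close> by \<open>resolvent\<close>, yet lie in the kernel of \<phi>.\<close>

lemma (in function_algebra) character_bound:
  assumes \<phi>: "character K S \<phi>" and f: "f \<in> S" and M: "\<And>x. x \<in> K \<Longrightarrow> norm (f x) \<le> M"
  shows "norm (\<phi> f) \<le> M"
proof (rule ccontr)
  assume "\<not> norm (\<phi> f) \<le> M"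
  then have M': "M < norm (\<phi> f)" by simp
  have r: "(\<lambda>x. 1 / (f x - \<phi> f)) \<in> S"
    using f M M' by (rule resolvent)
  have s: "(\<lambda>x. f x - \<phi> f) \<in> S"
    by (intro diff f const)
  have "1 = \<phi> (\<lambda>x. 1)" by (simp add: characterD(3)[OF \<phi>])
  also have "\<dots> = \<phi> (\<lambda>x. (f x - \<phi> f) * (1 / (f x - \<phi> f)))"
  proof (rule characterD(4)[OF \<phi> const mult[OF s r]])
    fix x assume "x \<in> K"
    then show "1 = (f x - \<phi> f) * (1 / (f x - \<phi> f))" using M[of x] M' by auto
  qed
  also have "\<dots> = 0"
    using characterD(2)[OF \<phi> s r] character_diff[OF \<phi> f const] characterD(3)[OF \<phi>] by simp
  finally show False by simp
qed

section \<open>Uniform limits of rational functions\<close>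

text \<open>The side condition of \<open>inverse\<close> keeps poles off \<open>K\<close>.
  Generating the functions inductively, rather than as quotients of polynomials, lets holomorphy and
  the action of characters be proved by rule induction.\<close>

inductive_set ratfun :: "complex set \<Rightarrow> (complex \<Rightarrow> complex) set" for K where
  const: "(\<lambda>_. c) \<in> ratfun K"
| ident: "(\<lambda>z. z) \<in> ratfun K"
| add: "\<lbrakk>f \<in> ratfun K; g \<in> ratfun K\<rbrakk> \<Longrightarrow> (\<lambda>z. f z + g z) \<in> ratfun K"
| mult: "\<lbrakk>f \<in> ratfun K; g \<in> ratfun K\<rbrakk> \<Longrightarrow> (\<lambda>z. f z * g z) \<in> ratfun K"
| inverse: "\<lbrakk>f \<in> ratfun K; \<And>z. z \<in> K \<Longrightarrow> f z \<noteq> 0\<rbrakk> \<Longrightarrow> (\<lambda>z. inverse (f z)) \<in> ratfun K"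

lemma ratfun_diff: "\<lbrakk>f \<in> ratfun K; g \<in> ratfun K\<rbrakk> \<Longrightarrow> (\<lambda>z. f z - g z) \<in> ratfun K"
  using ratfun.add[OF _ ratfun.mult[OF ratfun.const[of "-1"]], of f K g] by simp

lemma ratfun_power: "f \<in> ratfun K \<Longrightarrow> (\<lambda>z. f z ^ n) \<in> ratfun K"
  by (induction n) (auto intro: ratfun.const ratfun.mult)

lemma ratfun_prod: "(\<And>i. i \<in> I \<Longrightarrow> f i \<in> ratfun K) \<Longrightarrow> (\<lambda>z. \<Prod>i\<in>I. f i z) \<in> ratfun K"
  by (induction I rule: infinite_finite_induct) (auto intro: ratfun.const ratfun.mult)

lemma ratfun_mono:
  assumes "f \<in> ratfun L" "K \<subseteq> L"
  shows "f \<in> ratfun K"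
  using assms by (induction) (auto intro: ratfun.intros)

lemma ratfun_holomorphic:
  assumes "f \<in> ratfun K"
  obtains U where "open U" "K \<subseteq> U" "f holomorphic_on U"
proof -
  from assms have "\<exists>U. open U \<and> K \<subseteq> U \<and> f holomorphic_on U"
  proof induction
    case (const c)
    then show ?case by (intro exI[of _ UNIV]) (auto intro!: holomorphic_intros)
  next
    case ident
    then show ?case by (intro exI[of _ UNIV]) (auto intro!: holomorphic_intros)
  next
    case (add f g)
    then obtain U V where "open U" "K \<subseteq> U" "f holomorphic_on U" "open V" "K \<subseteq> V" "g holomorphic_on V"
      by blast
    then show ?case
      by (intro exI[of _ "U \<inter> V"]) (auto intro!: holomorphic_intros elim: holomorphic_on_subset)
  next
    case (mult f g)
    then obtain U V where "open U" "K \<subseteq> U" "f holomorphic_on U" "open V" "K \<subseteq> V" "g holomorphic_on V"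
      by blast
    then show ?case
      by (intro exI[of _ "U \<inter> V"]) (auto intro!: holomorphic_intros elim: holomorphic_on_subset)
  next
    case (inverse f)
    then obtain U where U: "open U" "K \<subseteq> U" "f holomorphic_on U"
      by blast
    \<comment> \<open>The neighbourhood is shrunk to avoid the zeros of \<open>f\<close>; it still
      contains \<open>K\<close>, where \<open>f\<close> has none.\<close>
    have "open (U \<inter> f -` (- {0}))"
      using U by (intro continuous_open_preimage holomorphic_on_imp_continuous_on) auto
    then show ?case
      using U inverse by (intro exI[of _ "U \<inter> f -` (- {0})"])
        (auto intro!: holomorphic_intros elim: holomorphic_on_subset)
  qed
  with that show thesis by blast
qed

definition R_alg :: "complex set \<Rightarrow> (complex \<Rightarrow> complex) set" where
  "R_alg K = {f. \<forall>e>0. \<exists>r\<in>ratfun K. \<forall>z\<in>K. norm (f z - r z) < e}"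

lemma R_algE:
  assumes "f \<in> R_alg K" "0 < e"
  obtains r where "r \<in> ratfun K" "\<And>z. z \<in> K \<Longrightarrow> norm (f z - r z) < e"
  using assms unfolding R_alg_def by blast

lemma ratfun_subset_R_alg: "ratfun K \<subseteq> R_alg K"
  by (auto simp: R_alg_def intro!: bexI)

lemma continuous_on_R_alg:
  assumes "f \<in> R_alg K"
  shows "continuous_on K f"
proof -
  have "\<exists>r. r \<in> ratfun K \<and> (\<forall>z\<in>K. norm (f z - r z) < inverse (real (Suc n)))" for n
    using assms unfolding R_alg_def mem_Collect_eq Bex_def by (auto dest!: spec[of _ "inverse (real (Suc n))"])
  then obtain r where r: "\<And>n. r n \<in> ratfun K"
    "\<And>n z. z \<in> K \<Longrightarrow> norm (f z - r n z) < inverse (real (Suc n))" by metis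
  show ?thesis
  proof (rule uniform_limit_theorem)
    show "\<forall>\<^sub>F n in sequentially. continuous_on K (r n)"
    proof (intro always_eventually allI)
      fix n show "continuous_on K (r n)"
        by (rule ratfun_holomorphic[OF r(1)[of n]])
          (auto intro: continuous_on_subset holomorphic_on_imp_continuous_on)
    qed
    show "uniform_limit K r f sequentially"
      unfolding uniform_limit_iff
    proof (intro allI impI)
      fix e :: real assume "0 < e"
      have "\<forall>\<^sub>F n in sequentially. inverse (real (Suc n)) < e"
        using LIMSEQ_inverse_real_of_nat \<open>0 < e\<close> by (rule order_tendstoD)
      then show "\<forall>\<^sub>F n in sequentially. \<forall>x\<in>K. dist (r n x) (f x) < e"
      proof eventually_elim
        case (elim n)
        show ?case
        proof
          fix x assume "x \<in> K"
          then show "dist (r n x) (f x) < e"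
            using r(2)[of x n] elim by (simp add: dist_norm norm_minus_commute)
        qed
      qed
    qed
  qed auto
qed

lemma function_algebra_R_alg:
  assumes "compact K"
  shows "function_algebra K (R_alg K)"
proof
  fix c show "(\<lambda>_. c) \<in> R_alg K"
    using ratfun_subset_R_alg ratfun.const by blast
next
  fix f g assume fg: "f \<in> R_alg K" "g \<in> R_alg K"
  show "(\<lambda>x. f x + g x) \<in> R_alg K"
    unfolding R_alg_def mem_Collect_eq
  proof (intro allI impI)
    fix e :: real assume "0 < e"
    then have "0 < e / 2" by simp
    obtain r where r: "r \<in> ratfun K" "\<And>z. z \<in> K \<Longrightarrow> norm (f z - r z) < e / 2"
      using R_algE[OF fg(1) \<open>0 < e / 2\<close>] by blast
    obtain s where s: "s \<in> ratfun K" "\<And>z. z \<in> K \<Longrightarrow> norm (g z - s z) < e / 2"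
      using R_algE[OF fg(2) \<open>0 < e / 2\<close>] by blast
    show "\<exists>r\<in>ratfun K. \<forall>z\<in>K. norm (f z + g z - r z) < e"
    proof (intro bexI[of _ "\<lambda>z. r z + s z"] ballI ratfun.add r s)
      fix z assume "z \<in> K"
      then show "norm (f z + g z - (r z + s z)) < e"
        using norm_add_less[of "f z - r z" "e / 2" "g z - s z" "e / 2"] r s by (simp add: algebra_simps)
    qed
  qed
  \<comment> \<open>Compactness of \<open>K\<close> bounds the factors, which uniform approximation
    of a product requires.\<close>
  have "\<exists>M. \<forall>z\<in>K. norm (h z) \<le> M" if "h \<in> R_alg K" for h
    using compact_imp_bounded[OF compact_continuous_image[OF continuous_on_R_alg[OF that] assms]]
    by (auto simp: bounded_iff)
  then obtain M N where M: "\<And>z. z \<in> K \<Longrightarrow> norm (f z) \<le> M" and N: "\<And>z. z \<in> K \<Longrightarrow> norm (g z) \<le> N"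
    using fg by meson
  show "(\<lambda>x. f x * g x) \<in> R_alg K"
    unfolding R_alg_def mem_Collect_eq
  proof (intro allI impI)
    fix e :: real assume "0 < e"
    \<comment> \<open>The bound \<open>d \<le> 1\<close> keeps the approximant \<open>s\<close> of
      \<open>g\<close> below \<open>\<bar>N\<bar> + 1\<close>; the other bound makes the total error
      \<open>d * (\<bar>M\<bar> + \<bar>N\<bar> + 1)\<close> less than \<open>e\<close>.\<close>
    define d where "d = min 1 (e / (2 * (\<bar>M\<bar> + \<bar>N\<bar> + 1)))"
    have d: "0 < d" "d \<le> 1"
      using \<open>0 < e\<close> by (auto simp: d_def)
    have "d * (\<bar>M\<bar> + \<bar>N\<bar> + 1) \<le> e / (2 * (\<bar>M\<bar> + \<bar>N\<bar> + 1)) * (\<bar>M\<bar> + \<bar>N\<bar> + 1)"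
      by (intro mult_right_mono) (auto simp: d_def)
    also have "\<dots> = e / 2" by (simp add: field_simps)
    finally have dMN: "d * (\<bar>M\<bar> + \<bar>N\<bar> + 1) < e"
      using \<open>0 < e\<close> by simp
    obtain r where r: "r \<in> ratfun K" "\<And>z. z \<in> K \<Longrightarrow> norm (f z - r z) < d"
      using R_algE[OF fg(1) d(1)] by blast
    obtain s where s: "s \<in> ratfun K" "\<And>z. z \<in> K \<Longrightarrow> norm (g z - s z) < d"
      using R_algE[OF fg(2) d(1)] by blast
    show "\<exists>r\<in>ratfun K. \<forall>z\<in>K. norm (f z * g z - r z) < e"
    proof (intro bexI[of _ "\<lambda>z. r z * s z"] ballI ratfun.mult r s)
      fix z assume z: "z \<in> K"
      have sN: "norm (s z) \<le> \<bar>N\<bar> + 1"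
        using s(2)[OF z] d(2) N[OF z] norm_triangle_ineq2[of "s z" "g z"] norm_minus_commute[of "s z" "g z"]
        by linarith
      have "f z * g z - r z * s z = f z * (g z - s z) + (f z - r z) * s z"
        by (simp add: algebra_simps)
      then have "norm (f z * g z - r z * s z) \<le> norm (f z) * norm (g z - s z) + norm (f z - r z) * norm (s z)"
        by (metis norm_mult norm_triangle_ineq)
      also have "\<dots> \<le> \<bar>M\<bar> * d + d * (\<bar>N\<bar> + 1)"
        using r(2)[OF z] s(2)[OF z] sN M[OF z] d by (intro add_mono mult_mono) auto
      finally show "norm (f z * g z - r z * s z) < e"
        using dMN by (simp add: algebra_simps)
    qed
  qed
next
  fix f assume *: "\<And>e. 0 < e \<Longrightarrow> \<exists>g\<in>R_alg K. \<forall>x\<in>K. norm (f x - g x) < e"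
  show "f \<in> R_alg K"
    unfolding R_alg_def mem_Collect_eq
  proof (intro allI impI)
    fix e :: real assume "0 < e"
    then have e: "0 < e / 2" by simp
    then obtain g where g: "g \<in> R_alg K" "\<forall>x\<in>K. norm (f x - g x) < e / 2"
      using *[of "e / 2"] by auto
    obtain r where r: "r \<in> ratfun K" "\<And>x. x \<in> K \<Longrightarrow> norm (g x - r x) < e / 2"
      using R_algE[OF g(1) e] by blast
    show "\<exists>r\<in>ratfun K. \<forall>z\<in>K. norm (f z - r z) < e"
    proof (intro bexI[of _ r] r ballI)
      fix z assume "z \<in> K"
      then show "norm (f z - r z) < e"
        using norm_add_less[of "f z - g z" "e / 2" "g z - r z" "e / 2"] r g by simp
    qed
  qed
qed

text \<open>The point is the value \<open>w\<close> of \<phi> at the identity function. It lies in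
  \<open>K\<close>, since otherwise \<open>z - w\<close> would be invertible and in the kernel. Then
  \<phi> is evaluation at \<open>w\<close> on rational functions by induction, and on their uniform
  limits by \<open>character_bound\<close>.\<close>

lemma character_R_alg:
  assumes K: "compact K" and \<phi>: "character K (R_alg K) \<phi>"
  shows "\<exists>z\<in>K. \<forall>f\<in>R_alg K. \<phi> f = f z"
proof -
  interpret function_algebra K "R_alg K"
    using K by (rule function_algebra_R_alg)
  have rat: "f \<in> R_alg K" if "f \<in> ratfun K" for f
    using ratfun_subset_R_alg that by blast
  define w where "w = \<phi> (\<lambda>z. z)"
  have w: "w \<in> K"
  proof (rule ccontr)
    assume "w \<notin> K"
    have a: "(\<lambda>z. z - w) \<in> ratfun K"
      by (intro ratfun_diff ratfun.intros)
    then have b: "(\<lambda>z. inverse (z - w)) \<in> ratfun K"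
      using \<open>w \<notin> K\<close> by (intro ratfun.inverse) auto
    have "1 = \<phi> (\<lambda>z. (z - w) * inverse (z - w))"
    proof (subst characterD(3)[OF \<phi>, of 1, symmetric], rule characterD(4)[OF \<phi> const mult[OF rat[OF a] rat[OF b]]])
      fix z assume "z \<in> K"
      then have "z - w \<noteq> 0" using \<open>w \<notin> K\<close> by auto
      then show "1 = (z - w) * inverse (z - w)" by simp
    qed
    also have "\<dots> = \<phi> (\<lambda>z. z - w) * \<phi> (\<lambda>z. inverse (z - w))"
      by (rule characterD(2)[OF \<phi> rat[OF a] rat[OF b]])
    also have "\<phi> (\<lambda>z. z - w) = 0"
      unfolding character_diff[OF \<phi> rat[OF ratfun.ident] const] characterD(3)[OF \<phi>] w_def by simp
    finally show False by simp
  qed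
  have \<phi>w: "\<phi> f = f w" if "f \<in> ratfun K" for f
    using that
  proof induction
    case (inverse f)
    have f: "f \<in> R_alg K" "(\<lambda>z. inverse (f z)) \<in> R_alg K"
      using inverse by (auto intro!: rat ratfun.inverse)
    have "\<phi> (\<lambda>_. 1) = \<phi> (\<lambda>z. f z * inverse (f z))"
      by (rule characterD(4)[OF \<phi> const mult[OF f]]) (use inverse in auto)
    then have "1 = f w * \<phi> (\<lambda>z. inverse (f z))"
      using inverse.IH by (simp add: characterD(2)[OF \<phi> f] characterD(3)[OF \<phi>])
    then show ?case using inverse.hyps(2)[OF w] by (simp add: field_simps)
  next
    case (const c)
    show ?case by (rule characterD(3)[OF \<phi>])
  next
    case ident
    show ?case by (simp add: w_def)
  next
    case (add f g)
    then show ?case by (simp add: characterD(1)[OF \<phi> rat[of f] rat[of g]])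
  next
    case (mult f g)
    then show ?case by (simp add: characterD(2)[OF \<phi> rat[of f] rat[of g]])
  qed
  have "\<phi> f = f w" if f: "f \<in> R_alg K" for f
  proof -
    have "norm (\<phi> f - f w) \<le> e" if "0 < e" for e
    proof -
      obtain r where r: "r \<in> ratfun K" "\<And>z. z \<in> K \<Longrightarrow> norm (f z - r z) < e / 2"
        using R_algE[OF f half_gt_zero[OF \<open>0 < e\<close>]] by blast
      have "norm (\<phi> (\<lambda>z. f z - r z)) \<le> e / 2"
        by (rule character_bound[OF \<phi> diff[OF f rat[OF r(1)]] less_imp_le[OF r(2)]])
      then have "norm (\<phi> f - r w) \<le> e / 2"
        using character_diff[OF \<phi> f rat[OF r(1)]] \<phi>w[OF r(1)] by simp
      moreover have "norm (r w - f w) \<le> e / 2"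
        using r(2)[OF w] by (simp add: norm_minus_commute)
      ultimately show ?thesis
        using norm_triangle_ineq[of "\<phi> f - r w" "r w - f w"] by (simp del: norm_triangle_ineq)
    qed
    then have "norm (\<phi> f - f w) \<le> 0"
      by (rule field_le_epsilon) auto
    then show ?thesis by simp
  qed
  with w show ?thesis by blast
qed

section \<open>Smooth cutoffs around discs\<close>

text \<open>The squared positive part is the simplest function with a continuous derivative that
  glues 0 to something positive.\<close>

definition possq :: "real \<Rightarrow> real" where "possq u = (max 0 u)\<^sup>2"

lemma possq_nonneg: "0 \<le> possq u"
  by (simp add: possq_def)

lemma DERIV_possq: "(possq has_real_derivative 2 * max 0 u) (at u)"
proof -
  consider "u < 0" | "u = 0" | "0 < u" by linarith
  then show ?thesis
  proof cases
    case 1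
    have "((\<lambda>_. 0) has_real_derivative 0) (at u)" by simp
    moreover have "\<forall>\<^sub>F x in nhds u. 0 = possq x"
      using eventually_nhds_in_open[of "{..<0}" u] 1 by (auto elim!: eventually_mono simp: possq_def)
    ultimately show ?thesis
      using 1 DERIV_cong_ev[of u u "\<lambda>_. 0" possq 0 0] by simp
  next
    case 3
    have "((\<lambda>x. x\<^sup>2) has_real_derivative 2 * u) (at u)"
      by (auto intro!: derivative_eq_intros)
    moreover have "\<forall>\<^sub>F x in nhds u. x\<^sup>2 = possq x"
      using eventually_nhds_in_open[of "{0<..}" u] 3 by (auto elim!: eventually_mono simp: possq_def)
    ultimately show ?thesis
      using 3 DERIV_cong_ev[of u u "\<lambda>x. x\<^sup>2" possq "2 * u" "2 * u"] by simp
  next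
    case 2
    \<comment> \<open>At the gluing point the difference quotient is \<open>possq h / h\<close>,
      which is at most \<open>\<bar>h\<bar>\<close> in modulus.\<close>
    have "(\<lambda>h. possq h / h) \<midarrow>0\<rightarrow> 0"
    proof (rule Lim_null_comparison)
      show "(\<lambda>h::real. \<bar>h\<bar>) \<midarrow>0\<rightarrow> 0"
        using tendsto_rabs[OF tendsto_ident_at[of "0::real" UNIV]] by simp
      show "\<forall>\<^sub>F h in at 0. norm (possq h / h) \<le> \<bar>h\<bar>"
        by (rule always_eventually) (auto simp: possq_def max_def power2_eq_square)
    qed
    then show ?thesis
      using 2 by (simp add: DERIV_def possq_def)
  qed
qed

text \<open>A continuously differentiable function that is \<open>0\<close> on \<open>t \<le> 1\<close> and \<open>1\<close> on \<open>2 \<le> t\<close>.\<close>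

definition cutoff :: "real \<Rightarrow> real" where "cutoff t = 1 - possq (1 - possq (t - 1))"
definition cutoff' :: "real \<Rightarrow> real" where "cutoff' t = 4 * max 0 (1 - possq (t - 1)) * max 0 (t - 1)"

lemma DERIV_cutoff: "(cutoff has_real_derivative cutoff' t) (at t)"
proof -
  have "((\<lambda>t. possq (t - 1)) has_real_derivative 2 * max 0 (t - 1) * 1) (at t)"
    by (rule DERIV_chain2[OF DERIV_possq]) (auto intro!: derivative_eq_intros)
  then have "((\<lambda>t. 1 - possq (t - 1)) has_real_derivative - (2 * max 0 (t - 1))) (at t)"
    using DERIV_diff[OF DERIV_const] by fastforce
  from DERIV_diff[OF DERIV_const[of 1] DERIV_chain2[OF DERIV_possq this]]
  show ?thesis by (simp add: cutoff_def [abs_def] cutoff'_def mult.assoc)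
qed

lemma continuous_on_cutoff': "continuous_on UNIV cutoff'"
  unfolding cutoff'_def possq_def by (intro continuous_intros)

lemma cutoff_bounds: "0 \<le> cutoff t" "cutoff t \<le> 1"
proof -
  have "max 0 (1 - possq (t - 1)) \<le> 1" using possq_nonneg[of "t - 1"] by auto
  then have "possq (1 - possq (t - 1)) \<le> 1\<^sup>2"
    unfolding possq_def[of "1 - possq (t - 1)"] by (intro power_mono) auto
  then show "0 \<le> cutoff t" by (simp add: cutoff_def)
  show "cutoff t \<le> 1" using possq_nonneg by (simp add: cutoff_def)
qed

lemma cutoff_low: "t \<le> 1 \<Longrightarrow> cutoff t = 0" "t \<le> 1 \<Longrightarrow> cutoff' t = 0"
  by (auto simp: cutoff_def cutoff'_def possq_def)

lemma cutoff_high: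
  assumes "2 \<le> t"
  shows "cutoff t = 1" "cutoff' t = 0"
proof -
  have "1\<^sup>2 \<le> (t - 1)\<^sup>2" using assms by (intro power_mono) auto
  then have "1 \<le> possq (t - 1)" using assms by (simp add: possq_def)
  then show "cutoff t = 1" "cutoff' t = 0"
    by (auto simp: cutoff_def cutoff'_def possq_def[of "1 - _"])
qed

lemma cutoff'_bound: "\<bar>cutoff' t\<bar> \<le> 4"
proof (cases "t < 2")
  case True
  have "max 0 (1 - possq (t - 1)) * max 0 (t - 1) \<le> 1 * 1"
    using possq_nonneg[of "t - 1"] True by (intro mult_mono) auto
  then show ?thesis by (simp add: cutoff'_def abs_mult)
next
  case False
  then show ?thesis by (simp add: cutoff_high)
qed

text \<open>A cutoff that is 0 on the disc \<open>d\<close> and 1 from \<open>sqrt 2\<close> times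
  its radius on. The squared distance is used because it is smooth at the centre as well.\<close>

definition hole :: "complex \<times> real \<Rightarrow> complex \<Rightarrow> real" where
  "hole d z = cutoff ((norm (z - fst d))\<^sup>2 / (snd d)\<^sup>2)"

text \<open>
  The gradient of a real function is read as a complex number, so that it equals the value of
  the Cauchy--Riemann operator \<open>\<partial>/\<partial>x + \<i> \<partial>/\<partial>y\<close>.
\<close>

definition hole_grad :: "complex \<times> real \<Rightarrow> complex \<Rightarrow> complex" where
  "hole_grad d z = (cutoff' ((norm (z - fst d))\<^sup>2 / (snd d)\<^sup>2) * (2 / (snd d)\<^sup>2)) *\<^sub>R (z - fst d)"

definition disc :: "complex \<times> real \<Rightarrow> complex set" where
  "disc d = ball (fst d) (snd d)"

text \<open>A square around the region where \<open>hole\<close> can differ from 1, with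
  \<open>3/2\<close> as a rational bound for \<open>sqrt 2\<close>. Being a box, it has an indicator
  whose integral is a content.\<close>

definition halo :: "complex \<times> real \<Rightarrow> complex set" where
  "halo d = cbox (fst d - Complex (3/2 * snd d) (3/2 * snd d)) (fst d + Complex (3/2 * snd d) (3/2 * snd d))"

lemma has_derivative_hole:
  assumes "0 < snd d"
  shows "(hole d has_derivative (\<lambda>v. hole_grad d z \<bullet> v)) (at z)"
proof -
  have 1: "((\<lambda>z. (norm (z - fst d))\<^sup>2 / (snd d)\<^sup>2) has_derivative (\<lambda>v. 2 * ((z - fst d) \<bullet> v) / (snd d)\<^sup>2)) (at z)"
    unfolding power2_norm_eq_inner divide_inverse
    using assms by (auto intro!: derivative_eq_intros simp: inner_commute field_simps)
  show ?thesis
    unfolding hole_def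
    by (rule has_derivative_eq_rhs[OF DERIV_compose_FDERIV[OF DERIV_cutoff 1]])
      (auto simp: hole_grad_def)
qed

lemma continuous_on_hole_grad: "continuous_on UNIV (hole_grad d)"
proof -
  have "continuous_on UNIV (\<lambda>z. cutoff' ((norm (z - fst d))\<^sup>2 * inverse ((snd d)\<^sup>2)))"
    by (rule continuous_on_compose2[OF continuous_on_cutoff']) (auto intro!: continuous_intros)
  then show ?thesis
    unfolding hole_grad_def divide_inverse by (intro continuous_intros)
qed

lemma hole_bounds: "0 \<le> hole d z" "hole d z \<le> 1"
  by (simp_all add: hole_def cutoff_bounds)

lemma hole_disc:
  assumes "0 < snd d" "z \<in> disc d"
  shows "hole d z = 0" "hole_grad d z = 0"
proof -
  have "(norm (z - fst d))\<^sup>2 \<le> (snd d)\<^sup>2"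
    using assms by (intro power_mono) (auto simp: disc_def dist_norm norm_minus_commute)
  then have "(norm (z - fst d))\<^sup>2 / (snd d)\<^sup>2 \<le> 1"
    using assms by (simp add: divide_le_eq)
  then show "hole d z = 0" "hole_grad d z = 0"
    by (simp_all add: hole_def hole_grad_def cutoff_low)
qed

lemma hole_near:
  assumes "0 < snd d" "(norm (z - fst d))\<^sup>2 / (snd d)\<^sup>2 < 2"
  shows "norm (z - fst d) < 3/2 * snd d" "z \<in> halo d"
proof -
  have "(norm (z - fst d))\<^sup>2 < 2 * (snd d)\<^sup>2"
    using assms by (simp add: divide_less_eq)
  also have "\<dots> \<le> (3/2 * snd d)\<^sup>2" by (simp add: power_mult_distrib power2_eq_square)
  finally show *: "norm (z - fst d) < 3/2 * snd d"
    by (rule power_less_imp_less_base) (use assms(1) in simp)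
  show "z \<in> halo d"
    using * abs_Re_le_cmod[of "z - fst d"] abs_Im_le_cmod[of "z - fst d"]
    unfolding halo_def in_cbox_complex_iff by auto
qed

lemma hole_outside:
  assumes "0 < snd d" "z \<notin> halo d"
  shows "hole d z = 1"
proof -
  have "2 \<le> (norm (z - fst d))\<^sup>2 / (snd d)\<^sup>2"
    using hole_near(2)[OF assms(1), of z] assms(2) not_less by blast
  then show ?thesis by (simp add: hole_def cutoff_high)
qed

text \<open>The gradient has size of order \<open>1 / r\<close> on a set of area of order
  \<open>r\<^sup>2\<close>, so its integral is of order \<open>r\<close>. This is why the sum of the
  radii is the quantity to be kept small.\<close>

lemma norm_hole_grad:
  assumes "0 < snd d"
  shows "norm (hole_grad d z) \<le> 12 / snd d * indicator (halo d) z"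
proof (cases "(norm (z - fst d))\<^sup>2 / (snd d)\<^sup>2 < 2")
  case True
  have "norm (hole_grad d z) = \<bar>cutoff' ((norm (z - fst d))\<^sup>2 / (snd d)\<^sup>2)\<bar> * (2 / (snd d)\<^sup>2) * norm (z - fst d)"
    by (simp add: hole_grad_def abs_mult)
  also have "\<dots> \<le> 4 * (2 / (snd d)\<^sup>2) * (3/2 * snd d)"
    using hole_near[OF assms True] assms by (intro mult_mono cutoff'_bound) auto
  also have "\<dots> = 12 / snd d" using assms by (simp add: power2_eq_square field_simps)
  finally show ?thesis using hole_near[OF assms True] by simp
next
  case False
  then show ?thesis using assms by (simp add: hole_grad_def cutoff_high)
qed

section \<open>Non-triviality of \<open>R(K)\<close>\<close>

text \<open>The total radius is bounded through finite subsets, so \<open>D\<close> may be infinite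
  without any summability statement.\<close>

definition small_discs :: "(complex \<times> real) set \<Rightarrow> real \<Rightarrow> bool" where
  "small_discs D e \<longleftrightarrow> (\<forall>d\<in>D. 0 < snd d) \<and> (\<forall>F. finite F \<and> F \<subseteq> D \<longrightarrow> (\<Sum>d\<in>F. snd d) \<le> e)"

text \<open>The outer region is a square instead of a disc, so that area integrals can be computed
  as iterated integrals.\<close>

definition cheese :: "(complex \<times> real) set \<Rightarrow> complex set" where
  "cheese D = cbox (- Complex 1 1) (Complex 1 1) - (\<Union>d\<in>D. disc d)"

section \<open>Area integrals and cutoff functions on the square\<close>

abbreviation square :: "(real \<times> real) set" where
  "square \<equiv> cbox (-1, -1) (1, 1)"

lemma Complex_in_square: "Complex x y \<in> cbox (- Complex 1 1) (Complex 1 1) \<longleftrightarrow> (x, y) \<in> square"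
  by (auto simp: in_cbox_complex_iff)

lemma compact_cheese: "compact (cheese D)"
  unfolding cheese_def disc_def by (intro compact_diff open_UN ballI) auto

lemma continuous_on_Complex: "continuous_on A (\<lambda>p. Complex (fst p) (snd p))"
  unfolding Complex_eq by (intro continuous_intros)

text \<open>With \<open>x\<close> as the inner variable, the inner integral is
  \<open>G 1 y - G (-1) y\<close> by the fundamental theorem of calculus.\<close>

lemma integral_dx_zero:
  fixes G :: "real \<Rightarrow> real \<Rightarrow> complex"
  assumes cont: "continuous_on square (\<lambda>p. g (fst p) (snd p))"
    and deriv: "\<And>x y. \<lbrakk>x \<in> {-1..1}; y \<in> {-1..1}\<rbrakk> \<Longrightarrow> ((\<lambda>x. G x y) has_vector_derivative g x y) (at x within {-1..1})"
    and bdry: "\<And>y. y \<in> {-1..1} \<Longrightarrow> G 1 y = G (-1) y"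
  shows "integral square (\<lambda>p. g (fst p) (snd p)) = 0"
proof -
  have "integral square (\<lambda>p. g (fst p) (snd p)) = integral (cbox (-1) 1) (\<lambda>x. integral (cbox (-1) 1) (\<lambda>y. g x y))"
    using integral_prod_continuous[OF cont] by simp
  also have "\<dots> = integral (cbox (-1) 1) (\<lambda>y. integral (cbox (-1) 1) (\<lambda>x. g x y))"
    by (rule integral_swap_continuous) (use cont in \<open>simp add: case_prod_unfold\<close>)
  also have "\<dots> = integral (cbox (-1) 1) (\<lambda>y::real. 0)"
  proof (rule integral_cong)
    fix y :: real assume "y \<in> cbox (-1) 1"
    then have "((\<lambda>x. g x y) has_integral (G 1 y - G (-1) y)) {-1..1}"
      by (intro fundamental_theorem_of_calculus deriv) auto
    then show "integral (cbox (-1) 1) (\<lambda>x. g x y) = 0"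
      using bdry \<open>y \<in> cbox (-1) 1\<close> by (simp add: integral_unique)
  qed
  finally show ?thesis by simp
qed

text \<open>Exchanging the coordinates reduces derivatives in the direction \<i> to
  \<open>integral_dx_zero\<close>.\<close>

lemma integral_square_swap:
  fixes g :: "real \<Rightarrow> real \<Rightarrow> complex"
  assumes cont: "continuous_on square (\<lambda>p. g (fst p) (snd p))"
  shows "integral square (\<lambda>p. g (fst p) (snd p)) = integral square (\<lambda>p. g (snd p) (fst p))"
    and "continuous_on square (\<lambda>p. g (snd p) (fst p))"
proof -
  show *: "continuous_on square (\<lambda>p. g (snd p) (fst p))"
    using continuous_on_compose2[OF cont continuous_on_swap[of square]]
    by (auto simp: case_prod_unfold)
  have "integral square (\<lambda>p. g (fst p) (snd p)) = integral (cbox (-1) 1) (\<lambda>x. integral (cbox (-1) 1) (\<lambda>y. g x y))"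
    using integral_prod_continuous[OF cont] by simp
  also have "\<dots> = integral (cbox (-1) 1) (\<lambda>y. integral (cbox (-1) 1) (\<lambda>x. g x y))"
    by (rule integral_swap_continuous) (use cont in \<open>simp add: case_prod_unfold\<close>)
  also have "\<dots> = integral square (\<lambda>p. g (snd p) (fst p))"
    using integral_prod_continuous[OF *] by simp
  finally show "integral square (\<lambda>p. g (fst p) (snd p)) = integral square (\<lambda>p. g (snd p) (fst p))" .
qed

text \<open>\<open>D z 1 + \<i> * D z \<i>\<close> is twice the derivative of \<open>F\<close> with respect to \<open>cnj z\<close>.\<close>

lemma integral_dbar_zero:
  fixes F :: "complex \<Rightarrow> complex"
  assumes deriv: "\<And>z. z \<in> cbox (- Complex 1 1) (Complex 1 1) \<Longrightarrow> (F has_derivative D z) (at z)"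
    and cont: "\<And>v. continuous_on (cbox (- Complex 1 1) (Complex 1 1)) (\<lambda>z. D z v)"
    and bdry: "\<And>x y. \<bar>x\<bar> = 1 \<or> \<bar>y\<bar> = 1 \<Longrightarrow> F (Complex x y) = 0"
  shows "integral square (\<lambda>p. D (Complex (fst p) (snd p)) 1 + \<i> * D (Complex (fst p) (snd p)) \<i>) = 0"
proof -
  have c: "continuous_on square (\<lambda>p. D (Complex (fst p) (snd p)) v)" for v
    by (rule continuous_on_compose2[OF cont continuous_on_Complex]) (auto simp: Complex_in_square)
  have 1: "integral square (\<lambda>p. D (Complex (fst p) (snd p)) 1) = 0"
  proof (rule integral_dx_zero[OF c, where G = "\<lambda>x y. F (Complex x y)"])
    fix x y :: real assume xy: "x \<in> {-1..1}" "y \<in> {-1..1}"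
    have "((\<lambda>x. Complex x y) has_vector_derivative 1) (at x within {-1..1})"
      unfolding Complex_eq has_vector_derivative_def
      by (auto intro!: derivative_eq_intros simp: scaleR_conv_of_real)
    from vector_derivative_diff_chain_within[OF this, of F "D (Complex x y)"]
    show "((\<lambda>x. F (Complex x y)) has_vector_derivative D (Complex x y) 1) (at x within {-1..1})"
      using deriv[of "Complex x y"] xy Complex_in_square[of x y]
      by (auto intro: has_derivative_at_withinI simp: o_def)
  qed (simp add: bdry)
  have "integral square (\<lambda>p. D (Complex (fst p) (snd p)) \<i>) = integral square (\<lambda>p. D (Complex (snd p) (fst p)) \<i>)"
    by (rule integral_square_swap[OF c])
  also have "\<dots> = 0"
  proof (rule integral_dx_zero[OF integral_square_swap(2)[OF c], where G = "\<lambda>y x. F (Complex x y)"])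
    fix y x :: real assume xy: "y \<in> {-1..1}" "x \<in> {-1..1}"
    have "((\<lambda>y. Complex x y) has_vector_derivative \<i>) (at y within {-1..1})"
      unfolding Complex_eq has_vector_derivative_def
      by (auto intro!: derivative_eq_intros simp: scaleR_conv_of_real)
    from vector_derivative_diff_chain_within[OF this, of F "D (Complex x y)"]
    show "((\<lambda>y. F (Complex x y)) has_vector_derivative D (Complex x y) \<i>) (at y within {-1..1})"
      using deriv[of "Complex x y"] xy Complex_in_square[of x y]
      by (auto intro: has_derivative_at_withinI simp: o_def)
  qed (simp add: bdry)
  finally have 2: "integral square (\<lambda>p. D (Complex (fst p) (snd p)) \<i>) = 0" .
  have "integral square (\<lambda>p. D (Complex (fst p) (snd p)) 1 + \<i> * D (Complex (fst p) (snd p)) \<i>) =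
      integral square (\<lambda>p. D (Complex (fst p) (snd p)) 1) + integral square (\<lambda>p. \<i> * D (Complex (fst p) (snd p)) \<i>)"
    by (intro integral_add integrable_continuous continuous_intros c)
  also have "integral square (\<lambda>p. \<i> * D (Complex (fst p) (snd p)) \<i>) = \<i> * integral square (\<lambda>p. D (Complex (fst p) (snd p)) \<i>)"
    by (rule integral_mult_right)
  finally show ?thesis using 1 2 by simp
qed

lemma halo_pair:
  "Complex (fst p) (snd p) \<in> halo d \<longleftrightarrow>
    p \<in> cbox (Re (fst d) - 3/2 * snd d, Im (fst d) - 3/2 * snd d) (Re (fst d) + 3/2 * snd d, Im (fst d) + 3/2 * snd d)"
  by (cases p) (auto simp: halo_def in_cbox_complex_iff)

text \<open>The part of a halo inside the square is again a box, contained in one of side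
  \<open>3 * snd d\<close>.\<close>

lemma integral_halo:
  assumes "0 < snd d"
  shows "(\<lambda>p. indicator (halo d) (Complex (fst p) (snd p)) :: real) integrable_on square"
    and "integral square (\<lambda>p. indicator (halo d) (Complex (fst p) (snd p)) :: real) \<le> 9 * (snd d)\<^sup>2"
proof -
  define B where "B = cbox (Re (fst d) - 3/2 * snd d, Im (fst d) - 3/2 * snd d) (Re (fst d) + 3/2 * snd d, Im (fst d) + 3/2 * snd d)"
  have eq: "(\<lambda>p. indicator (halo d) (Complex (fst p) (snd p)) :: real) = (\<lambda>p. if p \<in> B then 1 else 0)"
    unfolding B_def indicator_def halo_pair by auto
  obtain a b where ab: "B \<inter> square = cbox a b"
    using that[unfolded B_def, OF Int_interval] .
  have hi: "((\<lambda>p. if p \<in> B then 1 else 0 :: real) has_integral measure lborel (cbox a b)) square"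
    using has_integral_const[of "1::real" a b] by (simp add: has_integral_restrict_Int ab)
  have "measure lborel (cbox a b) \<le> measure lborel B"
    unfolding B_def by (rule content_subset) (use ab in \<open>auto simp: B_def\<close>)
  also have "measure lborel B = 9 * (snd d)\<^sup>2"
    using assms unfolding B_def by (simp add: content_Pair power2_eq_square)
  finally show "(\<lambda>p. indicator (halo d) (Complex (fst p) (snd p)) :: real) integrable_on square"
    and "integral square (\<lambda>p. indicator (halo d) (Complex (fst p) (snd p)) :: real) \<le> 9 * (snd d)\<^sup>2"
    using hi unfolding eq by (auto simp: integral_unique)
qed

text \<open>This factor vanishes on the boundary of the square, so that integration by parts leaves
  no boundary terms.\<close>

definition square_bump :: "complex \<Rightarrow> real" where
  "square_bump z = (1 - (Re z)\<^sup>2) * (1 - (Im z)\<^sup>2)"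

definition square_bump_grad :: "complex \<Rightarrow> complex" where
  "square_bump_grad z = Complex (- 2 * Re z * (1 - (Im z)\<^sup>2)) (- 2 * Im z * (1 - (Re z)\<^sup>2))"

lemma has_derivative_square_bump:
  "(square_bump has_derivative (\<lambda>v. square_bump_grad z \<bullet> v)) (at z)"
  unfolding square_bump_def
  by (auto intro!: derivative_eq_intros simp: square_bump_grad_def inner_complex_def algebra_simps)

lemma continuous_on_square_bump_grad: "continuous_on UNIV square_bump_grad"
  unfolding square_bump_grad_def Complex_eq by (intro continuous_intros)

lemma square_bump_bounds:
  assumes "z \<in> cbox (- Complex 1 1) (Complex 1 1)"
  shows "0 \<le> square_bump z" "square_bump z \<le> 1" "norm (square_bump_grad z) \<le> 4"
proof -
  have z: "\<bar>Re z\<bar> \<le> 1" "\<bar>Im z\<bar> \<le> 1" using assms by (auto simp: in_cbox_complex_iff)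
  then have b: "0 \<le> 1 - (Re z)\<^sup>2" "0 \<le> 1 - (Im z)\<^sup>2" "1 - (Re z)\<^sup>2 \<le> 1" "1 - (Im z)\<^sup>2 \<le> 1"
    by (auto simp: abs_square_le_1)
  then show "0 \<le> square_bump z" "square_bump z \<le> 1"
    unfolding square_bump_def by (auto intro: mult_nonneg_nonneg mult_le_one)
  have "\<bar>2 * Re z * (1 - (Im z)\<^sup>2)\<bar> \<le> (2 * 1) * 1" "\<bar>2 * Im z * (1 - (Re z)\<^sup>2)\<bar> \<le> (2 * 1) * 1"
    unfolding abs_mult using z b by (intro mult_mono; simp)+
  then show "norm (square_bump_grad z) \<le> 4"
    using cmod_le[of "square_bump_grad z"] by (simp add: square_bump_grad_def)
qed

definition holes :: "(complex \<times> real) set \<Rightarrow> complex \<Rightarrow> real" where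
  "holes F z = (\<Prod>d\<in>F. hole d z)"

definition holes_grad :: "(complex \<times> real) set \<Rightarrow> complex \<Rightarrow> complex" where
  "holes_grad F z = (\<Sum>d\<in>F. (\<Prod>e\<in>F - {d}. hole e z) *\<^sub>R hole_grad d z)"

lemma has_derivative_holes:
  assumes "\<And>d. d \<in> F \<Longrightarrow> 0 < snd d"
  shows "(holes F has_derivative (\<lambda>v. holes_grad F z \<bullet> v)) (at z)"
  unfolding holes_def
  by (rule has_derivative_eq_rhs[OF has_derivative_prod[OF has_derivative_hole[OF assms]]])
    (auto simp: holes_grad_def inner_sum_left mult.commute)

lemma continuous_on_holes_grad:
  assumes "\<And>d. d \<in> F \<Longrightarrow> 0 < snd d"
  shows "continuous_on UNIV (holes_grad F)"
proof -
  have "continuous_on UNIV (hole d)" if "d \<in> F" for d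
    using has_derivative_continuous[OF has_derivative_hole[OF assms[OF that]]]
    by (simp add: continuous_on_eq_continuous_at)
  then show ?thesis
    unfolding holes_grad_def by (intro continuous_intros continuous_on_hole_grad) auto
qed

lemma holes_bounds: "0 \<le> holes F z" "holes F z \<le> 1"
  unfolding holes_def by (auto intro!: prod_nonneg prod_le_1 simp: hole_bounds)

lemma holes_disc:
  assumes "finite F" "d \<in> F" "0 < snd d" "z \<in> disc d"
  shows "holes F z = 0" "holes_grad F z = 0"
proof -
  show "holes F z = 0"
    unfolding holes_def using assms by (intro prod_zero) (auto intro: hole_disc)
  show "holes_grad F z = 0"
    unfolding holes_grad_def
  proof (intro sum.neutral ballI)
    fix e assume "e \<in> F"
    show "(\<Prod>e\<in>F - {e}. hole e z) *\<^sub>R hole_grad e z = 0"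
    proof (cases "e = d")
      case True
      then show ?thesis using hole_disc(2)[OF assms(3,4)] by simp
    next
      case False
      then have "(\<Prod>e\<in>F - {e}. hole e z) = 0"
        using assms by (intro prod_zero) (auto intro!: bexI[of _ d] hole_disc)
      then show ?thesis by simp
    qed
  qed
qed

text \<open>In each summand of the product rule the undifferentiated factors are at most 1.\<close>

lemma norm_holes_grad:
  assumes "\<And>d. d \<in> F \<Longrightarrow> 0 < snd d"
  shows "norm (holes_grad F z) \<le> (\<Sum>d\<in>F. 12 / snd d * indicator (halo d) z)"
  unfolding holes_grad_def
proof (rule sum_norm_le)
  fix d assume "d \<in> F"
  have "norm ((\<Prod>e\<in>F - {d}. hole e z) *\<^sub>R hole_grad d z) = holes (F - {d}) z * norm (hole_grad d z)"
    using holes_bounds(1)[of "F - {d}" z] by (simp add: holes_def)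
  also have "\<dots> \<le> 1 * (12 / snd d * indicator (halo d) z)"
    by (intro mult_mono holes_bounds norm_hole_grad assms \<open>d \<in> F\<close>) auto
  finally show "norm ((\<Prod>e\<in>F - {d}. hole e z) *\<^sub>R hole_grad d z) \<le> 12 / snd d * indicator (halo d) z"
    by simp
qed

text \<open>Inside some halo the left side is at most 0; outside all halos every factor of the
  product is 1.\<close>

lemma holes_lower:
  assumes "finite F" "\<And>d. d \<in> F \<Longrightarrow> 0 < snd d"
  shows "1 - (\<Sum>d\<in>F. indicator (halo d) z) \<le> holes F z"
proof (cases "\<exists>d\<in>F. z \<in> halo d")
  case True
  then obtain d where d: "d \<in> F" "z \<in> halo d" by blast
  have "indicator (halo d) z \<le> (\<Sum>d\<in>F. indicator (halo d) z :: real)"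
    using assms d by (intro member_le_sum) auto
  then show ?thesis using d holes_bounds(1)[of F z] by simp
next
  case False
  then have "holes F z = 1"
    unfolding holes_def using assms by (intro prod.neutral) (auto intro: hole_outside)
  moreover have "0 \<le> (\<Sum>d\<in>F. indicator (halo d) z :: real)" by (intro sum_nonneg) auto
  ultimately show ?thesis by simp
qed

text \<open>For a rational \<open>f\<close> within \<open>1/100\<close> of \<open>cnj\<close>,
  integrating the Cauchy--Riemann operator of \<open>(f - cnj) * \<psi>\<close> gives
  \<open>\<integral> (f - cnj) g = 2 * \<integral> \<psi>\<close>, with \<open>g\<close> the
  gradient of \<psi>. The left side is at most \<open>1/5\<close> in modulus, while
  \<open>\<integral> \<psi>\<close> is at least \<open>9/16 - 9/100\<close>.\<close>

theorem cnj_notin_R_alg_cheese: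
  assumes D: "small_discs D (1/100)"
  shows "cnj \<notin> R_alg (cheese D)"
proof
  assume "cnj \<in> R_alg (cheese D)"
  then obtain f where f: "f \<in> ratfun (cheese D)" "\<And>z. z \<in> cheese D \<Longrightarrow> norm (cnj z - f z) < 1/100"
    by (rule R_algE[where e = "1/100"]) auto
  obtain U0 where U0: "open U0" "cheese D \<subseteq> U0" "f holomorphic_on U0"
    using ratfun_holomorphic[OF f(1)] .
  let ?Q = "cbox (- Complex 1 1) (Complex 1 1)"
  \<comment> \<open>\<open>U\<close> is an open neighbourhood of the cheese on which
    \<open>f\<close> is holomorphic and the approximation still holds. What remains of the square is
    compact, so finitely many of the discs cover it.\<close>
  define U where "U = U0 \<inter> (\<lambda>z. norm (cnj z - f z)) -` {..<1/100}"
  have openU: "open U"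
    unfolding U_def
    by (intro continuous_open_preimage continuous_intros holomorphic_on_imp_continuous_on U0) auto
  have "compact (?Q - U)" using openU by (intro compact_diff) auto
  moreover have "?Q - U \<subseteq> (\<Union>d\<in>D. disc d)"
    using U0(2) f(2) unfolding U_def cheese_def by blast
  moreover have "\<And>d. d \<in> D \<Longrightarrow> open (disc d)" by (simp add: disc_def)
  ultimately obtain F where F: "F \<subseteq> D" "finite F" "?Q - U \<subseteq> (\<Union>d\<in>F. disc d)"
    by (meson compactE_image)
  have pos: "0 < snd d" if "d \<in> F" for d
    using D F that by (auto simp: small_discs_def)
  have sumF: "(\<Sum>d\<in>F. snd d) \<le> 1/100"
    using D F by (auto simp: small_discs_def)
  define V where "V = (\<Union>d\<in>F. disc d)"
  have openV: "open V" by (auto simp: V_def disc_def)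
  have QUV: "?Q \<subseteq> U \<union> V" using F(3) by (auto simp: V_def)
  define \<psi> where "\<psi> = (\<lambda>z. square_bump z * holes F z)"
  define g where "g = (\<lambda>z. square_bump z *\<^sub>R holes_grad F z + holes F z *\<^sub>R square_bump_grad z)"
  have d\<psi>: "(\<psi> has_derivative (\<lambda>v. g z \<bullet> v)) (at z)" for z
    unfolding \<psi>_def
    by (rule has_derivative_eq_rhs[OF has_derivative_mult[OF has_derivative_square_bump has_derivative_holes[OF pos]]])
      (auto simp: g_def inner_add_left)
  have c\<psi>: "continuous_on UNIV \<psi>"
    using has_derivative_continuous[OF d\<psi>] by (simp add: continuous_on_eq_continuous_at)
  have cb: "continuous_on UNIV square_bump" "continuous_on UNIV (holes F)"
    using has_derivative_continuous[OF has_derivative_square_bump] has_derivative_continuous[OF has_derivative_holes[OF pos]]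
    by (simp_all add: continuous_on_eq_continuous_at)
  have cg: "continuous_on UNIV g"
    unfolding g_def
    using continuous_on_holes_grad[OF pos] cb continuous_on_square_bump_grad
    by (intro continuous_intros) auto
  have V0: "\<psi> z = 0" "g z = 0" if "z \<in> V" for z
    using that holes_disc[OF F(2)] pos by (auto simp: V_def \<psi>_def g_def)
  \<comment> \<open>The derivative of \<open>(f - cnj) * \<psi>\<close>. On \<open>V\<close>, where
    \<open>f\<close> may be arbitrary, both \<psi> and \<open>g\<close> vanish and so does
    \<open>DF\<close>.\<close>
  define DF where "DF = (\<lambda>z v. (deriv f z * v - cnj v) * of_real (\<psi> z) + (f z - cnj z) * of_real (g z \<bullet> v))"
  have "integral square (\<lambda>p. DF (Complex (fst p) (snd p)) 1 + \<i> * DF (Complex (fst p) (snd p)) \<i>) = 0"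
  proof (rule integral_dbar_zero[where F = "\<lambda>z. (f z - cnj z) * of_real (\<psi> z)"])
    fix z assume "z \<in> ?Q"
    then consider "z \<in> U" | "z \<in> V" using QUV by blast
    then show "((\<lambda>z. (f z - cnj z) * of_real (\<psi> z)) has_derivative DF z) (at z)"
    proof cases
      case 1
      then have "(f has_field_derivative deriv f z) (at z)"
        using U0 by (auto simp: U_def intro: holomorphic_derivI)
      then have "(f has_derivative (\<lambda>v. deriv f z * v)) (at z)"
        by (simp add: has_field_derivative_def)
      then show ?thesis
        unfolding DF_def
        by (auto intro!: derivative_eq_intros d\<psi>[THEN has_derivative_eq_rhs] bounded_linear.has_derivative[OF bounded_linear_cnj])
    next
      case 2
      have "((\<lambda>_. 0) has_derivative (\<lambda>_. 0)) (at z)" by simp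
      then have "((\<lambda>z. (f z - cnj z) * of_real (\<psi> z)) has_derivative (\<lambda>_. 0)) (at z)"
        by (rule has_derivative_transform_within_open[OF _ openV 2]) (simp add: V0)
      then show ?thesis using V0[OF 2] by (simp add: DF_def)
    qed
  next
    fix v
    have "continuous_on U (deriv f)"
      using U0 holomorphic_deriv[OF U0(3,1)]
      by (auto simp: U_def intro: continuous_on_subset holomorphic_on_imp_continuous_on)
    moreover have "continuous_on U f"
      using U0 by (auto simp: U_def intro: continuous_on_subset holomorphic_on_imp_continuous_on)
    moreover have "continuous_on U \<psi>" "continuous_on U g"
      using c\<psi> cg continuous_on_subset by blast+
    ultimately have "continuous_on U (\<lambda>z. DF z v)"
      unfolding DF_def by (intro continuous_intros)
    moreover have "continuous_on V (\<lambda>z. DF z v)"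
      by (rule continuous_on_eq[where f = "\<lambda>_. 0"]) (auto simp: DF_def V0)
    ultimately have "continuous_on (U \<union> V) (\<lambda>z. DF z v)"
      using openU openV by (intro continuous_on_open_Un)
    then show "continuous_on ?Q (\<lambda>z. DF z v)"
      using QUV continuous_on_subset by blast
  next
    fix x y :: real assume "\<bar>x\<bar> = 1 \<or> \<bar>y\<bar> = 1"
    then have "square_bump (Complex x y) = 0"
      by (auto simp: square_bump_def power2_eq_square abs_if split: if_splits)
    then show "(f (Complex x y) - cnj (Complex x y)) * of_real (\<psi> (Complex x y)) = 0"
      by (simp add: \<psi>_def)
  qed
  \<comment> \<open>The terms in \<open>deriv f\<close> cancel because
    \<open>1 + \<i> * \<i> = 0\<close>, while \<open>cnj\<close> contributes
    \<open>1 + \<i> * cnj \<i> = 2\<close>.\<close>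
  moreover have DFg: "DF z 1 + \<i> * DF z \<i> = (f z - cnj z) * g z - of_real (2 * \<psi> z)" for z
    unfolding DF_def by (simp add: complex_eq_iff inner_complex_def algebra_simps)
  moreover define H where "H = (\<lambda>z. (f z - cnj z) * g z)"
  ultimately have eq0: "integral square (\<lambda>p. H (Complex (fst p) (snd p)) - of_real (2 * \<psi> (Complex (fst p) (snd p)))) = 0"
    by simp
  have "continuous_on U f"
    using U0 by (auto simp: U_def intro: continuous_on_subset holomorphic_on_imp_continuous_on)
  then have "continuous_on U H"
    unfolding H_def using cg by (intro continuous_intros) (auto intro: continuous_on_subset)
  moreover have "continuous_on V H"
    by (rule continuous_on_eq[where f = "\<lambda>_. 0"]) (auto simp: H_def V0)
  ultimately have "continuous_on ?Q H"
    using continuous_on_subset[OF continuous_on_open_Un[OF openU openV] QUV] by blast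
  then have cH: "continuous_on square (\<lambda>p. H (Complex (fst p) (snd p)))"
    by (rule continuous_on_compose2[OF _ continuous_on_Complex]) (auto simp: Complex_in_square)
  have c\<psi>': "continuous_on square (\<lambda>p. \<psi> (Complex (fst p) (snd p)))"
    by (rule continuous_on_compose2[OF c\<psi> continuous_on_Complex]) auto
  define I where "I = integral square (\<lambda>p. \<psi> (Complex (fst p) (snd p)))"
  have "integral square (\<lambda>p. H (Complex (fst p) (snd p)) - of_real (2 * \<psi> (Complex (fst p) (snd p)))) =
      integral square (\<lambda>p. H (Complex (fst p) (snd p))) - integral square (\<lambda>p. complex_of_real (2 * \<psi> (Complex (fst p) (snd p))))"
    by (intro integral_diff integrable_continuous continuous_intros cH c\<psi>')
  also have "integral square (\<lambda>p. complex_of_real (2 * \<psi> (Complex (fst p) (snd p)))) = of_real (2 * I)"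
  proof -
    have "bounded_linear (\<lambda>x. complex_of_real (2 * x))"
      by (rule bounded_linear_compose[OF bounded_linear_of_real bounded_linear_mult_right])
    from integral_linear[OF integrable_continuous[OF c\<psi>'] this] show ?thesis
      by (simp add: o_def I_def)
  qed
  finally have HI: "integral square (\<lambda>p. H (Complex (fst p) (snd p))) = of_real (2 * I)"
    using eq0 by simp
  have isum: "(\<lambda>p. \<Sum>d\<in>F. w d * indicator (halo d) (Complex (fst p) (snd p)) :: real) integrable_on square" for w
    by (intro integrable_sum F integrable_on_mult_right integral_halo pos)
  have int_sum: "integral square (\<lambda>p. \<Sum>d\<in>F. w d * indicator (halo d) (Complex (fst p) (snd p)) :: real) \<le> (\<Sum>d\<in>F. w d * (9 * (snd d)\<^sup>2))"
    if "\<And>d. d \<in> F \<Longrightarrow> 0 \<le> w d" for w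
    by (subst integral_sum) (auto intro!: F integrable_on_mult_right integral_halo pos sum_mono mult_left_mono that)
  \<comment> \<open>Where \<open>H\<close> is non-zero, \<open>f - cnj\<close> is below
    \<open>1/100\<close>; the gradient of the bump is at most 4 and each hole contributes
    \<open>12 / snd d\<close> on its halo.\<close>
  have "norm (integral square (\<lambda>p. H (Complex (fst p) (snd p)))) \<le>
      integral square (\<lambda>p. 4 / 100 + (\<Sum>d\<in>F. (12 / snd d / 100) * indicator (halo d) (Complex (fst p) (snd p))))"
  proof (rule integral_norm_bound_integral)
    fix p :: "real \<times> real" assume p: "p \<in> square"
    let ?z = "Complex (fst p) (snd p)"
    have z: "?z \<in> ?Q" using p Complex_in_square[of "fst p" "snd p"] by simp
    have "norm (H ?z) \<le> 1/100 * norm (g ?z)"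
    proof (cases "?z \<in> V")
      case False
      then have "norm (cnj ?z - f ?z) < 1/100" using QUV z by (auto simp: U_def)
      then show ?thesis
        unfolding H_def norm_mult by (intro mult_right_mono) (auto simp: norm_minus_commute)
    qed (simp add: H_def V0)
    also have "norm (g ?z) \<le> norm (holes_grad F ?z) + norm (square_bump_grad ?z)"
      unfolding g_def
      using square_bump_bounds[OF z] holes_bounds[of F ?z]
      by (intro norm_triangle_mono) (auto intro!: mult_left_le_one_le)
    also have "\<dots> \<le> (\<Sum>d\<in>F. 12 / snd d * indicator (halo d) ?z) + 4"
      by (intro add_mono norm_holes_grad square_bump_bounds z pos)
    finally show "norm (H ?z) \<le> 4 / 100 + (\<Sum>d\<in>F. (12 / snd d / 100) * indicator (halo d) ?z)"
      by (simp add: sum_distrib_left sum_divide_distrib add_divide_distrib)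
  qed (intro integrable_continuous cH integrable_add integrable_const isum)+
  also have "\<dots> = integral square (\<lambda>p. 4 / 100) + integral square (\<lambda>p. \<Sum>d\<in>F. (12 / snd d / 100) * indicator (halo d) (Complex (fst p) (snd p)))"
    by (intro integral_add integrable_const isum)
  also have "\<dots> \<le> 16 / 100 + (\<Sum>d\<in>F. (12 / snd d / 100) * (9 * (snd d)\<^sup>2))"
    using pos by (intro add_mono int_sum) (auto simp: content_Pair intro: less_imp_le)
  also have "(\<Sum>d\<in>F. (12 / snd d / 100) * (9 * (snd d)\<^sup>2)) = 108 / 100 * (\<Sum>d\<in>F. snd d)"
    unfolding sum_distrib_left
  proof (rule sum.cong)
    fix d assume "d \<in> F"
    then show "(12 / snd d / 100) * (9 * (snd d)\<^sup>2) = 108 / 100 * snd d"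
      using pos[of d] by (simp add: power2_eq_square)
  qed simp
  finally have upper: "2 * \<bar>I\<bar> \<le> 1/5"
    using sumF unfolding HI by simp
  \<comment> \<open>The halo of \<open>d0\<close> is the square of half-side \<open>1/2\<close>,
    hence of area 1. On it both factors of the bump are at least \<open>3/4\<close>.\<close>
  define d0 :: "complex \<times> real" where "d0 = (0, 1/3)"
  have d0: "0 < snd d0" by (simp add: d0_def)
  define S where "S = (\<lambda>p. \<Sum>d\<in>F. 1 * indicator (halo d) (Complex (fst p) (snd p)) :: real)"
  define C where "C = (\<lambda>p. indicator (halo d0) (Complex (fst p) (snd p)) :: real)"
  have Cint: "integral square C = 1"
  proof -
    have C_eq: "C = (\<lambda>p. if p \<in> cbox (-1/2, -1/2) (1/2, 1/2) then 1 else 0)"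
      unfolding C_def indicator_def halo_pair d0_def by auto
    have sub: "cbox (-1/2, -1/2) (1/2, 1/2) \<inter> square = cbox (-1/2, -1/2) (1/2 :: real, 1/2 :: real)"
      by (auto simp: cbox_Pair_eq)
    have "(C has_integral measure lborel (cbox (-1/2, -1/2) (1/2 :: real, 1/2 :: real))) square"
      unfolding C_eq has_integral_restrict_Int sub using has_integral_const[of "1::real" "(-1/2, -1/2)" "(1/2 :: real, 1/2 :: real)"] by simp
    then show ?thesis by (simp add: integral_unique content_Pair)
  qed
  have "integral square (\<lambda>p. 9/16 * C p - S p) \<le> I"
    unfolding I_def
  proof (rule integral_le)
    show "(\<lambda>p. 9/16 * C p - S p) integrable_on square"
      unfolding S_def C_def
      by (intro integrable_diff integrable_on_mult_right integral_halo d0 isum)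
    show "(\<lambda>p. \<psi> (Complex (fst p) (snd p))) integrable_on square"
      by (intro integrable_continuous c\<psi>')
    fix p :: "real \<times> real" assume p: "p \<in> square"
    let ?z = "Complex (fst p) (snd p)"
    have z: "?z \<in> ?Q" using p Complex_in_square[of "fst p" "snd p"] by simp
    have C0: "0 \<le> C p" "C p \<le> 1" by (auto simp: C_def indicator_def)
    have S0: "0 \<le> S p" by (auto simp: S_def intro!: sum_nonneg)
    have h: "1 - S p \<le> holes F ?z"
      using holes_lower[OF F(2) pos] by (simp add: S_def)
    have b: "9/16 * C p \<le> square_bump ?z"
    proof (cases "?z \<in> halo d0")
      case True
      then have "\<bar>fst p\<bar> \<le> 1/2" "\<bar>snd p\<bar> \<le> 1/2"
        by (auto simp: halo_def d0_def in_cbox_complex_iff)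
      then have "(fst p)\<^sup>2 \<le> (1/2)\<^sup>2" "(snd p)\<^sup>2 \<le> (1/2)\<^sup>2"
        by (simp_all add: abs_le_square_iff[symmetric])
      then have "3/4 * (3/4) \<le> (1 - (fst p)\<^sup>2) * (1 - (snd p)\<^sup>2)"
        by (intro mult_mono) (auto simp: power2_eq_square)
      then show ?thesis using C0 True by (simp add: square_bump_def C_def)
    qed (use square_bump_bounds[OF z] in \<open>simp add: C_def\<close>)
    \<comment> \<open>Truncating \<open>S p\<close> at 1 keeps the second factor non-negative, so
      that the two lower bounds can be multiplied.\<close>
    have "9/16 * C p - S p \<le> 9/16 * C p * (1 - min 1 (S p))"
    proof (cases "S p \<le> 1")
      case True
      have "9/16 * C p * S p \<le> 1 * S p" using C0 S0 by (intro mult_right_mono) auto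
      then show ?thesis using True by (simp add: min_def algebra_simps)
    qed (use C0 in auto)
    also have "\<dots> \<le> square_bump ?z * holes F ?z"
      using h b C0 S0 holes_bounds[of F ?z] square_bump_bounds[OF z]
      by (intro mult_mono) (auto simp: min_def)
    finally show "9/16 * C p - S p \<le> \<psi> ?z" by (simp add: \<psi>_def)
  qed
  also have "integral square (\<lambda>p. 9/16 * C p - S p) = 9/16 * integral square C - integral square S"
    unfolding S_def C_def using isum[of "\<lambda>_. 1"]
    by (subst integral_diff) (auto intro!: integrable_on_mult_right integral_halo d0 isum)
  finally have "9/16 - integral square S \<le> I" using Cint by simp
  moreover have "integral square S \<le> (\<Sum>d\<in>F. 1 * (9 * (snd d)\<^sup>2))"
    unfolding S_def by (rule int_sum) auto
  moreover have "(\<Sum>d\<in>F. 1 * (9 * (snd d)\<^sup>2)) \<le> (\<Sum>d\<in>F. 9 * snd d)"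
  proof (rule sum_mono)
    fix d assume d: "d \<in> F"
    have "snd d \<le> (\<Sum>d\<in>F. snd d)"
      using d F(2) pos by (intro member_le_sum) (auto intro: less_imp_le)
    then have "snd d \<le> 1" using sumF by simp
    then show "1 * (9 * (snd d)\<^sup>2) \<le> 9 * snd d"
      using pos[OF d] by (simp add: power2_eq_square mult_left_le)
  qed
  moreover have "(\<Sum>d\<in>F. 9 * snd d) \<le> 9/100"
    using sumF by (simp add: sum_distrib_left[symmetric])
  ultimately show False using upper by simp
qed

section \<open>McKissick's lemma\<close>

text \<open>Each disc of a finite subfamily is assigned to one index \<open>k d\<close>; the
  contributions of the indices are then dominated by a geometric series with sum
  \<open>e\<close>.\<close>

lemma small_discs_UN:
  assumes "\<And>n::nat. small_discs (D n) (e / 2 ^ Suc n)" "0 \<le> e"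
  shows "small_discs (\<Union>n. D n) e"
  unfolding small_discs_def
proof (intro conjI allI impI)
  show "\<forall>d\<in>\<Union>n. D n. 0 < snd d"
    using assms(1) by (auto simp: small_discs_def)
next
  fix F assume F: "finite F \<and> F \<subseteq> (\<Union>n. D n)"
  then have "\<forall>d\<in>F. \<exists>n. d \<in> D n" by blast
  then obtain k where k: "\<And>d. d \<in> F \<Longrightarrow> d \<in> D (k d)" by metis
  have half: "(\<lambda>n. e / 2 ^ Suc n) sums e"
    using sums_mult[OF power_half_series, of e] by (simp add: power_divide)
  have "(\<Sum>d\<in>F. snd d) = (\<Sum>i\<in>k ` F. \<Sum>d\<in>{d\<in>F. k d = i}. snd d)"
    using F by (intro sum.image_gen) auto
  also have "\<dots> \<le> (\<Sum>i\<in>k ` F. e / 2 ^ Suc i)"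
  proof (rule sum_mono)
    fix i
    have "finite {d\<in>F. k d = i}" "{d\<in>F. k d = i} \<subseteq> D i" using F k by auto
    then show "(\<Sum>d\<in>{d\<in>F. k d = i}. snd d) \<le> e / 2 ^ Suc i"
      using assms(1)[of i] unfolding small_discs_def by blast
  qed
  also have "\<dots> \<le> (\<Sum>n. e / 2 ^ Suc n)"
    using F assms(2) half by (intro sum_le_suminf) (auto simp: sums_iff)
  also have "\<dots> = e" using half by (simp add: sums_iff)
  finally show "(\<Sum>d\<in>F. snd d) \<le> e" .
qed

text \<open>If \<open>u ^ N\<close> is close to \<open>1\<close>, dividing \<open>u\<close> by \<open>exp (Ln (u ^ N) / N)\<close> gives a nearby root of unity.\<close>

lemma norm_one_minus_power_ge:
  fixes u :: complex
  assumes N: "0 < N" and \<delta>: "0 < \<delta>" "\<delta> \<le> 1"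
    and far: "\<And>w. w ^ N = 1 \<Longrightarrow> \<delta> / N \<le> norm (u - w)"
  shows "\<delta> / 4 \<le> norm (1 - u ^ N)"
proof (rule ccontr)
  assume "\<not> \<delta> / 4 \<le> norm (1 - u ^ N)"
  then have v: "norm (u ^ N - 1) < \<delta> / 4" by (simp add: norm_minus_commute)
  define L where "L = Ln (u ^ N)"
  have "u ^ N \<noteq> 0"
  proof
    assume "u ^ N = 0"
    with v \<delta> show False by simp
  qed
  then have eL: "exp L = u ^ N" by (simp add: L_def)
  have "norm L \<le> 2 * norm (u ^ N - 1)"
    using norm_Ln_le[of "u ^ N - 1"] v \<delta> by (simp add: L_def)
  then have L: "norm L < \<delta> / 2" using v by simp
  define w where "w = u / exp (L / N)"
  have "exp (L / N) ^ N = u ^ N"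
    using N eL by (simp add: exp_of_nat_mult[symmetric])
  then have w: "w ^ N = 1" using \<open>u ^ N \<noteq> 0\<close> by (simp add: w_def power_divide)
  then have nw: "norm w = 1"
    using N by (metis norm_ge_zero norm_one norm_power power_eq_1_iff neq0_conv)
  have LN: "norm (L / N) = norm L / N" by (simp add: norm_divide)
  have "norm L / N \<le> norm L / 1" using N by (intro divide_left_mono) auto
  then have "norm (L / N) \<le> 1 / 2" using L \<delta> LN by linarith
  then have e: "norm (exp (L / N) - 1) \<le> 3 / 2 * norm (L / N)"
    by (rule norm_exp_bounds)
  have "u - w = w * (exp (L / N) - 1)" by (simp add: w_def field_simps)
  then have "norm (u - w) \<le> 3 / 2 * (norm L / N)"
    using e nw LN by (simp add: norm_mult)
  also have "\<dots> < 3 / 2 * ((\<delta> / 2) / N)"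
    using L N by (intro mult_strict_left_mono divide_strict_right_mono) auto
  also have "\<dots> \<le> \<delta> / N" using \<delta> N by (simp add: field_simps)
  finally show False using far[OF w] by simp
qed

text \<open>The poles are \<open>s\<close> times the \<open>N\<close>-th roots of unity. As
  \<open>N\<close> grows, \<open>(t / s) ^ N\<close> tends to infinity and
  \<open>(p / s) ^ N\<close> to 0, so a single large \<open>N\<close> makes the function almost 0
  outside radius \<open>t\<close> and almost 1 inside radius \<open>p\<close>.\<close>

lemma exists_sharp_power:
  assumes p: "0 \<le> p" "p < s" "s < t" and \<eta>: "0 < \<eta>" "\<eta> \<le> (1::real)"
  obtains N where "0 < (N::nat)"
    and "\<And>v::complex. t \<le> norm v \<Longrightarrow> norm (inverse (1 - (v / of_real s) ^ N)) \<le> \<eta>"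
    and "\<And>v::complex. norm v \<le> p \<Longrightarrow> norm (inverse (1 - (v / of_real s) ^ N) - 1) \<le> \<eta>"
proof -
  have ts: "1 < t / s" using p by simp
  then obtain N0 where N0: "1 + 1 / \<eta> < (t / s) ^ N0"
    using real_arch_pow by blast
  have 1: "\<forall>\<^sub>F N in sequentially. 1 + 1 / \<eta> \<le> (t / s) ^ N"
    using eventually_ge_at_top[of N0]
  proof eventually_elim
    case (elim N)
    then have "(t / s) ^ N0 \<le> (t / s) ^ N" using ts by (intro power_increasing) auto
    then show ?case using N0 by simp
  qed
  have "(\<lambda>N. (p / s) ^ N) \<longlonglongrightarrow> 0"
    using p by (intro LIMSEQ_power_zero) auto
  then have 2: "\<forall>\<^sub>F N in sequentially. (p / s) ^ N < \<eta> / 2"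
    using \<eta> by (intro order_tendstoD) auto
  have "\<forall>\<^sub>F N in sequentially. 1 + 1 / \<eta> \<le> (t / s) ^ N \<and> (p / s) ^ N < \<eta> / 2 \<and> 0 < N"
    using 1 2 eventually_gt_at_top[of 0] by eventually_elim auto
  from eventually_happens'[OF sequentially_bot this]
  obtain N where N: "1 + 1 / \<eta> \<le> (t / s) ^ N" "(p / s) ^ N < \<eta> / 2" "0 < N"
    by blast
  show thesis
  proof (rule that[OF N(3)])
    fix v :: complex assume "t \<le> norm v"
    then have "t / s \<le> norm (v / of_real s)"
      using p by (simp add: norm_divide divide_right_mono)
    then have "(t / s) ^ N \<le> norm ((v / of_real s) ^ N)"
      using p unfolding norm_power by (intro power_mono) auto
    then have "1 / \<eta> \<le> norm (1 - (v / of_real s) ^ N)"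
      using N(1) norm_triangle_ineq2[of "(v / of_real s) ^ N" 1] by (simp add: norm_minus_commute)
    then have "inverse (norm (1 - (v / of_real s) ^ N)) \<le> inverse (1 / \<eta>)"
      using \<eta> by (intro le_imp_inverse_le) auto
    then show "norm (inverse (1 - (v / of_real s) ^ N)) \<le> \<eta>"
      by (simp add: norm_inverse)
  next
    fix v :: complex assume "norm v \<le> p"
    define x where "x = (v / of_real s) ^ N"
    have "norm (v / of_real s) \<le> p / s"
      using p \<open>norm v \<le> p\<close> by (simp add: norm_divide divide_right_mono)
    then have "norm x \<le> (p / s) ^ N"
      unfolding x_def norm_power by (intro power_mono) auto
    then have x: "norm x \<le> \<eta> / 2" using N(2) by simp
    then have x1: "1 / 2 \<le> norm (1 - x)"
      using norm_triangle_ineq2[of 1 x] \<eta> by simp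
    then have "1 - x \<noteq> 0" by auto
    then have "inverse (1 - x) - 1 = x / (1 - x)" by (simp add: field_simps)
    then have "norm (inverse (1 - x) - 1) = norm x / norm (1 - x)" by (simp add: norm_divide)
    also have "\<dots> \<le> (\<eta> / 2) / (1 / 2)" using x x1 \<eta> by (intro frac_le) auto
    finally show "norm (inverse (1 - (v / of_real s) ^ N) - 1) \<le> \<eta>"
      by (simp add: x_def)
  qed
qed

lemma R_alg_uniform_limit:
  assumes "\<And>n. f n \<in> ratfun K" "uniform_limit K f g sequentially"
  shows "g \<in> R_alg K"
  unfolding R_alg_def mem_Collect_eq
proof (intro allI impI)
  fix e :: real assume "0 < e"
  then have "\<forall>\<^sub>F n in sequentially. \<forall>x\<in>K. dist (f n x) (g x) < e"
    using assms(2) by (auto simp: uniform_limit_iff)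
  from eventually_happens'[OF sequentially_bot this]
  obtain n where "\<forall>x\<in>K. dist (f n x) (g x) < e" ..
  then show "\<exists>r\<in>ratfun K. \<forall>z\<in>K. norm (g z - r z) < e"
    using assms(1) by (auto simp: dist_norm norm_minus_commute intro!: bexI[of _ "f n"])
qed

text \<open>The function is the infinite product of the \<open>g n\<close>, whose poles lie on
  circles of radii increasing to \<open>R\<close>; the discs remove these poles. Outside the ball
  every factor is small, inside it the factors tend to 1 so fast that the product stays non-zero.
  The disc centred in the ball serves later to make the cheese nowhere dense.\<close>

theorem McKissick:
  fixes a :: complex
  assumes R: "0 < R" and e: "0 < e"
  obtains D f where "small_discs D e" "\<exists>d\<in>D. fst d \<in> ball a R"
    and "f \<in> R_alg (- (\<Union>d\<in>D. disc d))"
    and "\<And>z. z \<notin> (\<Union>d\<in>D. disc d) \<Longrightarrow> f z = 0 \<longleftrightarrow> z \<notin> ball a R"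
proof -
  \<comment> \<open>The radii interlace, \<open>p n < s n < p (Suc n)\<close>, start at
    \<open>p 0 = 0\<close> and tend to \<open>R\<close>: poles at \<open>s n\<close>, good bounds
    inside \<open>p n\<close> and outside \<open>p (Suc n)\<close>.\<close>
  define p where "p = (\<lambda>n. R * (1 - 1 / (2 * real n + 1)))"
  define s where "s = (\<lambda>n. R * (1 - 1 / (2 * real n + 2)))"
  have p0: "0 \<le> p n" and ps: "p n < s n" and sp: "s n < p (Suc n)" and pR: "p n < R" and s0: "0 < s n" and sR: "s n < R" for n
  proof -
    have x: "1 / (2 * real n + 3) < 1 / (2 * real n + 2)" "1 / (2 * real n + 2) < 1 / (2 * real n + 1)"
      by (intro divide_strict_left_mono; simp)+
    have y: "1 / (2 * real n + 1) \<le> 1" "1 / (2 * real n + 2) < 1" "0 < 1 / (2 * real n + 1)" "0 < 1 / (2 * real n + 2)"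
      by simp_all
    have pSuc: "p (Suc n) = R * (1 - 1 / (2 * real n + 3))" by (simp add: p_def algebra_simps)
    have mono: "R * u < R * v" if "u < v" for u v using that R by (rule mult_strict_left_mono)
    show "0 \<le> p n" using R y by (simp add: p_def)
    show "p n < s n" unfolding p_def s_def by (rule mono) (use x in linarith)
    show "s n < p (Suc n)" unfolding pSuc s_def by (rule mono) (use x in linarith)
    show "p n < R" using mono[of "1 - 1 / (2 * real n + 1)" 1] y by (simp add: p_def)
    show "0 < s n" using R y by (simp add: s_def)
    show "s n < R" using mono[of "1 - 1 / (2 * real n + 2)" 1] y by (simp add: s_def)
  qed
  have p_mono: "p m \<le> p n" if "m \<le> n" for m n
    using lift_Suc_mono_le[of p m n] that less_trans[OF ps sp] by (auto intro: less_imp_le)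
  \<comment> \<open>The discs of stage \<open>n\<close> have total radius at most
    \<open>R * \<delta> n\<close>, which must not exceed \<open>e / 2 ^ Suc n\<close>. The cap 1 is
    required by \<open>norm_one_minus_power_ge\<close>.\<close>
  define \<delta> where "\<delta> = (\<lambda>n::nat. min 1 (e / (R * 2 ^ Suc n)))"
  have \<delta>: "0 < \<delta> n" "\<delta> n \<le> 1" "R * \<delta> n \<le> e / 2 ^ Suc n" for n
  proof -
    show "0 < \<delta> n" "\<delta> n \<le> 1" using R e by (auto simp: \<delta>_def)
    have "R * \<delta> n \<le> R * (e / (R * 2 ^ Suc n))" using R by (intro mult_left_mono) (auto simp: \<delta>_def)
    then show "R * \<delta> n \<le> e / 2 ^ Suc n" using R by simp
  qed
  define M where "M = (\<lambda>n. 4 / \<delta> n)"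
  have M: "1 \<le> M n" for n
    using \<delta>[of n] by (simp add: M_def field_simps)
  \<comment> \<open>\<open>M n\<close> bounds the factor \<open>g n\<close> off its discs. The error \<open>\<eta> n\<close> of \<open>g n\<close> away from its circle
    must absorb all earlier factors and the next one, the only one near its own circle.\<close>
  define \<eta> where "\<eta> = (\<lambda>n. 1 / (2 ^ (n + 2) * ((M (Suc n) + 1) * (\<Prod>m\<le>n. M m))))"
  have PM: "1 \<le> (\<Prod>m\<le>n. M m)" "1 \<le> (\<Prod>m<n. M m)" for n by (auto intro!: prod_ge_1 M)
  have \<eta>: "0 < \<eta> n" "\<eta> n * (M (Suc n) + 1) \<le> 1 / 2 ^ (n + 2)" "\<eta> n * (\<Prod>m<n. M m) \<le> 1 / 2 ^ (n + 2)" "\<eta> n \<le> 1 / 2 ^ (n + 2)" "\<eta> n \<le> 1" for n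
  proof -
    define A where "A = M (Suc n) + 1"
    define B where "B = (\<Prod>m\<le>n. M m)"
    have A: "1 \<le> A" using M[of "Suc n"] by (simp add: A_def)
    have B: "1 \<le> B" "(\<Prod>m<n. M m) \<le> B"
      using PM(1)[of n] PM(2)[of n] M[of n] by (auto simp: B_def lessThan_Suc_atMost[symmetric])
    have \<eta>AB: "\<eta> n = 1 / 2 ^ (n + 2) / (A * B)" by (simp add: \<eta>_def A_def B_def)
    show pos: "0 < \<eta> n" using A B by (simp add: \<eta>AB)
    have *: "\<eta> n * (A * B) = 1 / 2 ^ (n + 2)" using A B by (simp add: \<eta>AB)
    have bd: "\<eta> n * x \<le> 1 / 2 ^ (n + 2)" if "x \<le> A * B" for x
      using mult_left_mono[OF that, of "\<eta> n"] pos * by simp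
    have AB: "A \<le> A * B" "(\<Prod>m<n. M m) \<le> A * B" "1 \<le> A * B"
      using A B mult_mono[of 1 A "(\<Prod>m<n. M m)" B] PM(2)[of n] mult_mono[of 1 A 1 B] by auto
    show "\<eta> n * (M (Suc n) + 1) \<le> 1 / 2 ^ (n + 2)" "\<eta> n * (\<Prod>m<n. M m) \<le> 1 / 2 ^ (n + 2)"
      using bd[OF AB(1)] bd[OF AB(2)] by (simp_all add: A_def)
    show le: "\<eta> n \<le> 1 / 2 ^ (n + 2)" using bd[OF AB(3)] by simp
    have "(1::real) \<le> 2 ^ (n + 2)" by (rule one_le_power) simp
    then have "1 / 2 ^ (n + 2) \<le> (1::real)" by (subst divide_le_eq_1_pos) auto
    with le show "\<eta> n \<le> 1" by (rule order_trans)
  qed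
  have "\<exists>N>0. (\<forall>v::complex. p (Suc n) \<le> norm v \<longrightarrow> norm (inverse (1 - (v / of_real (s n)) ^ N)) \<le> \<eta> n) \<and>
      (\<forall>v::complex. norm v \<le> p n \<longrightarrow> norm (inverse (1 - (v / of_real (s n)) ^ N) - 1) \<le> \<eta> n)" for n
    by (rule exists_sharp_power[OF p0 ps sp \<eta>(1) \<eta>(5)]) blast
  then obtain N where N0: "\<And>n. 0 < (N n :: nat)"
    and Nout: "\<And>n v::complex. p (Suc n) \<le> norm v \<Longrightarrow> norm (inverse (1 - (v / of_real (s n)) ^ N n)) \<le> \<eta> n"
    and Nin: "\<And>n v::complex. norm v \<le> p n \<Longrightarrow> norm (inverse (1 - (v / of_real (s n)) ^ N n) - 1) \<le> \<eta> n"
    by metis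
  define g where "g = (\<lambda>n z. inverse (1 - ((z - a) / of_real (s n)) ^ N n))"
  \<comment> \<open>One disc around each of the \<open>N n\<close> poles of \<open>g n\<close>. Its
    radius is \<open>s n * \<delta> n\<close> divided by \<open>N n\<close>, so the total does not
    depend on \<open>N n\<close>.\<close>
  define DD where "DD = (\<lambda>n. (\<lambda>w. (a + of_real (s n) * w, s n * \<delta> n / N n)) ` {w. w ^ N n = 1})"
  define D where "D = (\<Union>n. DD n)"
  define W where "W = - (\<Union>d\<in>D. disc d)"
  have "small_discs (DD n) (e / 2 ^ Suc n)" for n
    unfolding small_discs_def
  proof (intro conjI allI impI ballI)
    fix d assume "d \<in> DD n"
    then show "0 < snd d" using s0 \<delta>(1) N0 by (auto simp: DD_def)
  next
    fix F assume F: "finite F \<and> F \<subseteq> DD n"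
    have fin: "finite {w::complex. w ^ N n = 1}" using N0[of n] by (intro finite_roots_unity) auto
    then have "finite (DD n)" by (simp add: DD_def)
    then have "card F \<le> card (DD n)" using F by (intro card_mono) auto
    also have "\<dots> \<le> card {w::complex. w ^ N n = 1}" unfolding DD_def by (rule card_image_le[OF fin])
    also have "\<dots> = N n" using N0 by (rule card_roots_unity_eq)
    finally have card: "card F \<le> N n" .
    have "(\<Sum>d\<in>F. snd d) = (\<Sum>d\<in>F. s n * \<delta> n / N n)"
      using F by (intro sum.cong) (auto simp: DD_def)
    also have "\<dots> = card F * (s n * \<delta> n / N n)" by simp
    also have "\<dots> \<le> N n * (s n * \<delta> n / N n)"
      using card s0[of n] \<delta>(1)[of n] by (intro mult_right_mono) auto
    also have "\<dots> = s n * \<delta> n" using N0[of n] by simp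
    also have "\<dots> \<le> R * \<delta> n" using sR[of n] \<delta>(1)[of n] by (intro mult_right_mono) auto
    also have "\<dots> \<le> e / 2 ^ Suc n" by (rule \<delta>)
    finally show "(\<Sum>d\<in>F. snd d) \<le> e / 2 ^ Suc n" .
  qed
  then have smallD: "small_discs D e"
    unfolding D_def using e by (intro small_discs_UN) auto
  have center: "\<exists>d\<in>D. fst d \<in> ball a R"
  proof (intro bexI)
    show "(a + of_real (s 0) * 1, s 0 * \<delta> 0 / N 0) \<in> D" unfolding D_def DD_def by (intro UN_I[of 0] imageI) auto
    show "fst (a + of_real (s 0) * 1, s 0 * \<delta> 0 / N 0) \<in> ball a R"
      using sR[of 0] s0[of 0] by (simp add: dist_norm)
  qed
  have gW: "\<delta> n / 4 \<le> norm (1 - ((z - a) / of_real (s n)) ^ N n)" if "z \<in> W" for n z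
  proof (rule norm_one_minus_power_ge[OF N0 \<delta>(1,2)])
    fix w :: complex assume w: "w ^ N n = 1"
    then have "(a + of_real (s n) * w, s n * \<delta> n / N n) \<in> D" by (auto simp: D_def DD_def)
    then have "z \<notin> disc (a + of_real (s n) * w, s n * \<delta> n / N n)" using that by (auto simp: W_def)
    then have "s n * \<delta> n / N n \<le> norm (z - (a + of_real (s n) * w))"
      by (simp add: disc_def dist_norm norm_minus_commute)
    also have "z - (a + of_real (s n) * w) = of_real (s n) * ((z - a) / of_real (s n) - w)"
      using s0[of n] by (simp add: field_simps)
    also have "norm \<dots> = s n * norm ((z - a) / of_real (s n) - w)"
      using s0[of n] by (simp add: norm_mult)
    finally have "s n * (\<delta> n / N n) \<le> s n * norm ((z - a) / of_real (s n) - w)" by simp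
    then show "\<delta> n / N n \<le> norm ((z - a) / of_real (s n) - w)"
      using s0[of n] by (simp only: mult_le_cancel_left_pos)
  qed
  have gne: "1 - ((z - a) / of_real (s n)) ^ N n \<noteq> 0" if "z \<in> W" for n z
    using gW[OF that, of n] \<delta>(1)[of n] by auto
  have gM: "norm (g n z) \<le> M n" if "z \<in> W" for n z
    using le_imp_inverse_le[OF gW[OF that, of n]] \<delta>(1)[of n] by (simp add: g_def norm_inverse M_def)
  have gout: "norm (g n z) \<le> \<eta> n" if "p (Suc n) \<le> norm (z - a)" for n z
    using Nout[OF that] by (simp add: g_def)
  have gin: "norm (g n z - 1) \<le> \<eta> n" if "norm (z - a) \<le> p n" for n z
    using Nin[OF that] by (simp add: g_def)
  define P where "P = (\<lambda>n z. \<Prod>m<n. g m z)"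
  have PSuc: "P (Suc n) z = P n z * g n z" for n z by (simp add: P_def)
  \<comment> \<open>Such a point lies beyond the circles of all factors up to \<open>k\<close>: the
    earlier ones are at most 1 in modulus and the last is at most \<open>\<eta> k\<close>.\<close>
  have Pout: "norm (P (Suc k) z) \<le> \<eta> k" if "p (Suc k) \<le> norm (z - a)" for k z
  proof -
    have "norm (g m z) \<le> 1" if "m < k" for m
    proof -
      have "p (Suc m) \<le> norm (z - a)"
        using p_mono[of "Suc m" "Suc k"] that \<open>p (Suc k) \<le> _\<close> by simp
      from gout[OF this] \<eta>(5)[of m] show ?thesis by simp
    qed
    then have "norm (P k z) \<le> 1"
      unfolding P_def prod_norm[symmetric] by (intro prod_le_1) auto
    then have "norm (P k z) * norm (g k z) \<le> 1 * \<eta> k"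
      using gout[OF that] by (intro mult_mono) auto
    then show ?thesis by (simp add: PSuc norm_mult)
  qed
  \<comment> \<open>Within radius \<open>p n\<close> the new factor is so close to 1 that
    \<open>\<eta> n\<close> outweighs the product of the bounds \<open>M m\<close>. Beyond
    \<open>p n\<close> the product \<open>P n\<close> is at most \<open>\<eta> (n - 1)\<close>,
    which outweighs \<open>M n + 1\<close>; this case uses a preceding factor, hence
    \<open>1 \<le> n\<close>.\<close>
  have step: "norm (P (Suc n) z - P n z) \<le> (1 / 2) ^ n" if z: "z \<in> W" and n: "1 \<le> n" for n z
  proof -
    have diff: "norm (P (Suc n) z - P n z) = norm (P n z) * norm (g n z - 1)"
      by (simp add: PSuc norm_mult[symmetric] algebra_simps)
    show ?thesis
    proof (cases "norm (z - a) \<le> p n")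
      case True
      have "norm (P n z) \<le> (\<Prod>m<n. M m)"
        unfolding P_def prod_norm[symmetric] by (intro prod_mono) (auto intro: gM z)
      then have "norm (P n z) * norm (g n z - 1) \<le> (\<Prod>m<n. M m) * \<eta> n"
        using gin[OF True] PM(2)[of n] by (intro mult_mono) auto
      also have "\<dots> \<le> 1 / 2 ^ (n + 2)" using \<eta>(3)[of n] by (simp add: mult.commute)
      also have "\<dots> \<le> (1 / 2) ^ n" by (simp add: field_simps)
      finally show ?thesis by (simp add: diff)
    next
      case False
      obtain k where k: "n = Suc k" using n by (cases n) auto
      have "norm (P n z) \<le> \<eta> k" using Pout[of k z] False k by simp
      moreover have "norm (g n z - 1) \<le> M (Suc k) + 1"
        using norm_triangle_ineq4[of "g n z" 1] gM[OF z, of n] k by simp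
      ultimately have "norm (P n z) * norm (g n z - 1) \<le> \<eta> k * (M (Suc k) + 1)"
        using \<eta>(1)[of k] by (intro mult_mono) auto
      also have "\<dots> \<le> 1 / 2 ^ (k + 2)" by (rule \<eta>)
      also have "\<dots> \<le> (1 / 2) ^ n" using k by (simp add: field_simps)
      finally show ?thesis by (simp add: diff)
    qed
  qed
  \<comment> \<open>The limit of the \<open>P n\<close> as a telescoping series, to which the
    Weierstrass test applies; the summand 1 is \<open>P 0\<close>.\<close>
  define f where "f = (\<lambda>z. 1 + (\<Sum>n. P (Suc n) z - P n z))"
  have ul: "uniform_limit W P f sequentially"
  proof -
    have "uniform_limit W (\<lambda>n z. \<Sum>i<n. P (Suc i) z - P i z) (\<lambda>z. \<Sum>n. P (Suc n) z - P n z) sequentially"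
    proof (rule Weierstrass_m_test_ev)
      show "\<forall>\<^sub>F n in sequentially. \<forall>z\<in>W. norm (P (Suc n) z - P n z) \<le> (1 / 2) ^ n"
        using eventually_ge_at_top[of 1] by eventually_elim (auto intro: step)
      show "summable (\<lambda>n. (1 / 2 :: real) ^ n)" by (rule summable_geometric) simp
    qed
    then have "uniform_limit W (\<lambda>n z. 1 + (\<Sum>i<n. P (Suc i) z - P i z)) f sequentially"
      unfolding f_def by (intro uniform_limit_intros)
    moreover have "(\<Sum>i<n. P (Suc i) z - P i z) = P n z - 1" for n z
      using sum_lessThan_telescope[of "\<lambda>n. P n z" n] by (simp add: P_def)
    ultimately show ?thesis by simp
  qed
  have lim: "(\<lambda>n. P n z) \<longlonglongrightarrow> f z" if "z \<in> W" for z
    using tendsto_uniform_limitI[OF ul that] .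
  have fR: "f \<in> R_alg W"
  proof (rule R_alg_uniform_limit[OF _ ul])
    fix n
    have "(\<lambda>z. 1 - ((z - a) * inverse (of_real (s m))) ^ N m) \<in> ratfun W" for m
      by (intro ratfun_diff ratfun.const ratfun_power ratfun.mult ratfun.ident)
    then have "g m \<in> ratfun W" for m
      using ratfun.inverse[of "\<lambda>z. 1 - ((z - a) / of_real (s m)) ^ N m"] gne
      by (simp add: g_def divide_inverse)
    then show "P n \<in> ratfun W"
      unfolding P_def by (intro ratfun_prod)
  qed
  have fz: "f z = 0 \<longleftrightarrow> z \<notin> ball a R" if z: "z \<in> W" for z
  proof
    assume f0: "f z = 0"
    show "z \<notin> ball a R"
    proof
      assume "z \<in> ball a R"
      then have zR: "norm (z - a) < R" by (simp add: dist_norm norm_minus_commute)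
      have "(\<lambda>n. p n) \<longlonglongrightarrow> R"
      proof -
        have "(\<lambda>n. inverse (real (Suc (2 * n)))) \<longlonglongrightarrow> 0"
          using LIMSEQ_subseq_LIMSEQ[OF LIMSEQ_inverse_real_of_nat, of "\<lambda>n. 2 * n"]
          by (simp add: strict_mono_def o_def)
        then have "(\<lambda>n. R * (1 - inverse (real (Suc (2 * n))))) \<longlonglongrightarrow> R * (1 - 0)"
          by (intro tendsto_intros)
        then show ?thesis by (simp add: p_def divide_inverse add.commute)
      qed
      then have "\<forall>\<^sub>F n in sequentially. norm (z - a) < p n"
        using zR by (rule order_tendstoD)
      then obtain n0 where n0: "\<And>n. n0 \<le> n \<Longrightarrow> norm (z - a) < p n"
        by (auto simp: eventually_sequentially)
      have Pn0: "P n0 z \<noteq> 0" using gne[OF z] by (auto simp: P_def g_def)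
      \<comment> \<open>From \<open>n0\<close> on each factor is at least
        \<open>1 - \<eta> n\<close> in modulus. The slack \<open>1 / 2 ^ Suc n\<close> pays for
        these losses, so the partial products never fall below half of the non-zero
        \<open>P n0 z\<close>.\<close>
      have "norm (P n0 z) * (1 / 2 + 1 / 2 ^ Suc n) \<le> norm (P n z)" if "n0 \<le> n" for n
        using that
      proof (induction n rule: dec_induct)
        case base
        have "1 / 2 + 1 / 2 ^ Suc n0 \<le> (1::real)" using one_le_power[of "2::real" n0] by (simp add: field_simps)
        then show ?case using mult_left_le[of "1 / 2 + 1 / 2 ^ Suc n0" "norm (P n0 z)"] by simp
      next
        case (step n)
        define x :: real where "x = 1 / 2 ^ Suc n"
        have x: "0 < x" "x \<le> 1 / 2" using one_le_power[of "2::real" n] by (auto simp: x_def field_simps)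
        have \<eta>x: "\<eta> n \<le> x / 2" using \<eta>(4)[of n] by (simp add: x_def)
        have "x * x \<le> x * (1 / 2)" using x by (intro mult_left_mono) auto
        then have "1 / 2 + x / 2 \<le> (1 / 2 + x) * (1 - x / 2)" by (simp add: algebra_simps)
        then have "norm (P n0 z) * (1 / 2 + x / 2) \<le> norm (P n0 z) * (1 / 2 + x) * (1 - x / 2)"
          unfolding mult.assoc by (intro mult_left_mono) auto
        also have "\<dots> \<le> norm (P n z) * norm (g n z)"
        proof (intro mult_mono)
          show "norm (P n0 z) * (1 / 2 + x) \<le> norm (P n z)" using step.IH by (simp add: x_def)
          have "norm (g n z - 1) \<le> x / 2" using gin[of z n] n0[OF step.hyps(1)] \<eta>x by simp
          then show "1 - x / 2 \<le> norm (g n z)"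
            using norm_triangle_ineq2[of 1 "1 - g n z"] by (simp add: norm_minus_commute)
        qed (use x in auto)
        finally show ?case by (simp add: PSuc norm_mult x_def)
      qed
      moreover have "norm (P n0 z) * (1 / 2) \<le> norm (P n0 z) * (1 / 2 + 1 / 2 ^ Suc n)" for n
        by (intro mult_left_mono) auto
      ultimately have "norm (P n0 z) * (1 / 2) \<le> norm (P n z)" if "n0 \<le> n" for n
        using that order_trans by blast
      then have "norm (P n0 z) * (1 / 2) \<le> norm (f z)"
        by (intro LIMSEQ_le_const[OF tendsto_norm[OF lim[OF z]]]) auto
      then show False using Pn0 f0 by simp
    qed
  next
    assume "z \<notin> ball a R"
    then have "p (Suc n) \<le> norm (z - a)" for n
      using pR[of "Suc n"] by (simp add: dist_norm norm_minus_commute)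
    then have P0: "norm (P (Suc n) z) \<le> (1 / 2) ^ n" for n
    proof -
      have "norm (P (Suc n) z) \<le> 1 / 2 ^ (n + 2)" using Pout[of n z] \<open>\<And>n. p (Suc n) \<le> _\<close> \<eta>(4)[of n] order_trans by blast
      also have "\<dots> \<le> (1 / 2) ^ n" by (simp add: field_simps)
      finally show ?thesis .
    qed
    have "(\<lambda>n. P (Suc n) z) \<longlonglongrightarrow> 0"
      by (rule Lim_null_comparison[OF _ LIMSEQ_power_zero[of "1 / 2 :: real"]]) (use P0 in auto)
    then show "f z = 0"
      using LIMSEQ_Suc[OF lim[OF z]] LIMSEQ_unique by blast
  qed
  show thesis
    using that[OF smallD center] fR fz unfolding W_def by blast
qed

section \<open>A regular Swiss cheese\<close>

lemma R_alg_mono: "f \<in> R_alg L \<Longrightarrow> K \<subseteq> L \<Longrightarrow> f \<in> R_alg K"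
  unfolding R_alg_def mem_Collect_eq by (meson ratfun_mono subsetD)

text \<open>McKissick's discs are removed for every ball of a countable base, with total radius at
  most \<open>1/100\<close>. Every basic ball then contains the centre of a removed disc, so
  \<open>K\<close> has empty interior, and the function attached to a basic ball around
  \<open>x\<close> that misses \<open>C\<close> separates \<open>x\<close> from
  \<open>C\<close>.\<close>

theorem regular_swiss_cheese:
  obtains K where "compact K" "K \<subseteq> cball 0 2" "interior K = {}" "cnj \<notin> R_alg K"
    and "\<And>x C. \<lbrakk>x \<in> K; closed C; x \<notin> C\<rbrakk> \<Longrightarrow> \<exists>f\<in>R_alg K. f x = 1 \<and> (\<forall>z\<in>K \<inter> C. f z = 0)"
proof -
  obtain Q :: "complex set" where Q: "countable Q" "\<And>X. open X \<Longrightarrow> X \<noteq> {} \<Longrightarrow> \<exists>d\<in>Q. d \<in> X"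
    using countable_dense_setE by blast
  \<comment> \<open>The index \<open>i\<close> codes a point of the countable dense set together
    with a radius \<open>1 / (j + 1)\<close>.\<close>
  define a where "a = (\<lambda>i. from_nat_into Q (fst (prod_decode i)))"
  define R where "R = (\<lambda>i. inverse (real (Suc (snd (prod_decode i)))))"
  have base: "\<exists>i. z \<in> ball (a i) (R i) \<and> ball (a i) (R i) \<subseteq> U" if U: "open U" "z \<in> U" for U z
  proof -
    obtain e where e: "0 < e" "ball z e \<subseteq> U" using U openE by blast
    \<comment> \<open>With radius below \<open>e / 2\<close>, a ball whose centre is within that
      radius of \<open>z\<close> contains \<open>z\<close> and stays inside
      \<open>ball z e\<close>.\<close>
    obtain j where j: "inverse (real (Suc j)) < e / 2"
      using reals_Archimedean[of "e / 2"] e by auto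
    obtain d where d: "d \<in> Q" "d \<in> ball z (inverse (real (Suc j)))"
      using Q(2)[of "ball z (inverse (real (Suc j)))"] by auto
    define i where "i = prod_encode (to_nat_on Q d, j)"
    have "a i = d" "R i = inverse (real (Suc j))"
      using from_nat_into_to_nat_on[OF Q(1) d(1)] by (simp_all add: a_def R_def i_def)
    moreover have "ball d (inverse (real (Suc j))) \<subseteq> ball z e"
    proof
      fix y assume "y \<in> ball d (inverse (real (Suc j)))"
      then show "y \<in> ball z e"
        using d(2) j dist_triangle[of z y d] by simp
    qed
    moreover have "z \<in> ball d (inverse (real (Suc j)))" using d(2) by (simp add: dist_commute)
    ultimately show ?thesis using e(2) by (metis order_trans)
  qed
  have R0: "0 < R i" for i by (simp add: R_def)
  have "\<exists>D f. small_discs D ((1/100) / 2 ^ Suc i) \<and> (\<exists>d\<in>D. fst d \<in> ball (a i) (R i)) \<and>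
      f \<in> R_alg (- (\<Union>d\<in>D. disc d)) \<and> (\<forall>z. z \<notin> (\<Union>d\<in>D. disc d) \<longrightarrow> (f z = 0 \<longleftrightarrow> z \<notin> ball (a i) (R i)))" for i
  proof (rule McKissick[OF R0, of "(1/100) / 2 ^ Suc i" "a i" i])
    show "0 < (1/100) / (2::real) ^ Suc i" by simp
  qed (intro exI conjI allI impI)
  then obtain D f where small: "\<And>i. small_discs (D i) ((1/100) / 2 ^ Suc i)"
    and center: "\<And>i. \<exists>d\<in>D i. fst d \<in> ball (a i) (R i)"
    and f: "\<And>i. f i \<in> R_alg (- (\<Union>d\<in>D i. disc d))"
    and f0: "\<And>i z. z \<notin> (\<Union>d\<in>D i. disc d) \<Longrightarrow> f i z = 0 \<longleftrightarrow> z \<notin> ball (a i) (R i)"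
    by metis
  define DD where "DD = (\<Union>i. D i)"
  have DD: "small_discs DD (1/100)"
    unfolding DD_def using small by (intro small_discs_UN) auto
  define K where "K = cheese DD"
  have notdisc: "z \<notin> (\<Union>d\<in>D i. disc d)" if "z \<in> K" for z i
    using that by (auto simp: K_def cheese_def DD_def)
  show thesis
  proof
    show cK: "compact K" by (simp add: K_def compact_cheese)
    show "K \<subseteq> cball 0 2"
    proof
      fix z assume "z \<in> K"
      then have "\<bar>Re z\<bar> \<le> 1" "\<bar>Im z\<bar> \<le> 1" by (auto simp: K_def cheese_def in_cbox_complex_iff)
      then show "z \<in> cball 0 2" using cmod_le[of z] by simp
    qed
    show "cnj \<notin> R_alg K" unfolding K_def using DD by (rule cnj_notin_R_alg_cheese)
    show "interior K = {}"
    proof (rule ccontr)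
      assume "interior K \<noteq> {}"
      then obtain z where "z \<in> interior K" by blast
      then obtain i where i: "ball (a i) (R i) \<subseteq> interior K"
        using base[OF open_interior] by blast
      obtain d where d: "d \<in> D i" "fst d \<in> ball (a i) (R i)" using center by blast
      then have "fst d \<in> K" using i interior_subset by blast
      moreover have "fst d \<in> disc d" using small[of i] d by (auto simp: disc_def small_discs_def)
      ultimately show False using notdisc d by blast
    qed
    fix x C assume x: "x \<in> K" "closed C" "x \<notin> C"
    then obtain i where i: "x \<in> ball (a i) (R i)" "ball (a i) (R i) \<subseteq> - C"
      using base[of "- C" x] by auto
    interpret function_algebra K "R_alg K" using cK by (rule function_algebra_R_alg)
    have fx: "f i x \<noteq> 0" using f0[OF notdisc[OF x(1)]] i by blast
    have fK: "f i \<in> R_alg K" using R_alg_mono[OF f] notdisc by blast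
    show "\<exists>f\<in>R_alg K. f x = 1 \<and> (\<forall>z\<in>K \<inter> C. f z = 0)"
    proof (intro bexI conjI ballI)
      show "(\<lambda>z. inverse (f i x) * f i z) \<in> R_alg K" by (rule mult[OF const fK])
      show "inverse (f i x) * f i x = 1" using fx by simp
      fix z assume "z \<in> K \<inter> C"
      then show "inverse (f i x) * f i z = 0" using f0[OF notdisc, of z i] i by auto
    qed
  qed
qed

section \<open>Extension from closed sets after collapsing\<close>

text \<open>\<open>Y\<close> is the image of \<open>q\<close> with the final topology: a subset of
  the image is open iff its preimage is.\<close>

lemma exists_quotient_map:
  obtains Y where "quotient_map X Y q"
proof -
  define Q where "Q = (\<lambda>U. U \<subseteq> q ` topspace X \<and> openin X {x \<in> topspace X. q x \<in> U})"
  have "istopology Q"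
    unfolding istopology_def
  proof (intro conjI allI impI)
    fix S T assume "Q S" "Q T"
    moreover have "{x \<in> topspace X. q x \<in> S \<inter> T} = {x \<in> topspace X. q x \<in> S} \<inter> {x \<in> topspace X. q x \<in> T}"
      by blast
    ultimately show "Q (S \<inter> T)" unfolding Q_def by auto
  next
    fix \<K> assume "\<forall>S\<in>\<K>. Q S"
    moreover have "{x \<in> topspace X. q x \<in> \<Union>\<K>} = (\<Union>S\<in>\<K>. {x \<in> topspace X. q x \<in> S})"
      by blast
    ultimately show "Q (\<Union>\<K>)" unfolding Q_def by auto
  qed
  then have op: "openin (topology Q) U \<longleftrightarrow> Q U" for U
    by (simp add: topology_inverse')
  have "Q (q ` topspace X)"
  proof -
    have "{x \<in> topspace X. q x \<in> q ` topspace X} = topspace X" by blast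
    then show ?thesis by (simp add: Q_def)
  qed
  then have "q ` topspace X \<subseteq> topspace (topology Q)"
    using op openin_subset by blast
  moreover have "topspace (topology Q) \<subseteq> q ` topspace X"
    using op[of "topspace (topology Q)"] by (auto simp: Q_def)
  ultimately have ts: "q ` topspace X = topspace (topology Q)" by simp
  show thesis
    by (rule that[of "topology Q"]) (auto simp: quotient_map_def op ts[symmetric], auto simp: Q_def)
qed

text \<open>Near a point \<open>x\<close> outside the set, finitely many \<open>T m\<close> are
  avoided because their union is closed. The remaining ones have diameter below \<open>e / 2\<close>
  and meet \<open>C\<close>, so one coming within \<open>e / 2\<close> of \<open>x\<close> would put
  a point of \<open>C\<close> into \<open>ball x e\<close>.\<close>

lemma closed_null_saturation:
  fixes C :: "'a::metric_space set" and T :: "nat \<Rightarrow> 'a set"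
  assumes C: "closed C" and T: "\<And>m. closed (T m)"
    and meet: "\<And>m. m \<in> J \<Longrightarrow> T m \<inter> C \<noteq> {}"
    and s: "\<And>m x y. \<lbrakk>x \<in> T m; y \<in> T m\<rbrakk> \<Longrightarrow> dist x y \<le> s m" and s0: "s \<longlonglongrightarrow> (0::real)"
  shows "closed (C \<union> (\<Union>m\<in>J. T m))"
  unfolding closed_def open_dist
proof (intro ballI)
  fix x assume x: "x \<in> - (C \<union> (\<Union>m\<in>J. T m))"
  then obtain e where e: "0 < e" "ball x e \<subseteq> - C"
    using C openE[of "- C" x] by auto
  have "\<forall>\<^sub>F m in sequentially. s m < e / 2"
    using s0 e by (intro order_tendstoD) auto
  then obtain N where N: "\<And>m. N \<le> m \<Longrightarrow> s m < e / 2"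
    by (auto simp: eventually_sequentially)
  have "closed (\<Union>m\<in>J \<inter> {..<N}. T m)" by (intro closed_UN) (auto simp: T)
  then have "open (- (\<Union>m\<in>J \<inter> {..<N}. T m))" by (rule open_Compl)
  moreover have "x \<in> - (\<Union>m\<in>J \<inter> {..<N}. T m)" using x by blast
  ultimately obtain e' where e': "0 < e'" "ball x e' \<subseteq> - (\<Union>m\<in>J \<inter> {..<N}. T m)"
    by (rule openE)
  show "\<exists>e>0. \<forall>y. dist y x < e \<longrightarrow> y \<in> - (C \<union> (\<Union>m\<in>J. T m))"
  proof (intro exI[of _ "min e' (e / 2)"] conjI allI impI)
    fix y assume y: "dist y x < min e' (e / 2)"
    have "y \<notin> C" using e(2) y e(1) by (auto simp: dist_commute subset_eq)
    moreover have "y \<notin> T m" if m: "m \<in> J" for m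
    proof
      assume ym: "y \<in> T m"
      show False
      proof (cases "m < N")
        case True
        then show False using e'(2) y ym m by (auto simp: dist_commute subset_eq)
      next
        case False
        obtain c where c: "c \<in> T m" "c \<in> C" using meet[OF m] by blast
        have "dist x c < e"
          using s[OF ym c(1)] N[of m] False y dist_triangle[of x c y] by (simp add: dist_commute)
        then show False using e(2) c by auto
      qed
    qed
    ultimately show "y \<in> - (C \<union> (\<Union>m\<in>J. T m))" by blast
  qed (use e e' in auto)
qed

text \<open>
  The extension is Tietze's theorem on the space obtained from \<open>X\<close> by collapsing each \<open>T m\<close>
  with \<open>m \<in> J\<close> to a point. It is normal because the quotient map is closed, the sets \<open>T m\<close>
  having diameters that tend to 0.
\<close>

lemma Tietze_collapsed_real:
  fixes X :: "'a::metric_space set" and T :: "nat \<Rightarrow> 'a set" and h :: "'a \<Rightarrow> real"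
  assumes X: "closed X" and T: "\<And>m. closed (T m)" "\<And>m. T m \<subseteq> X"
    and disj: "\<And>m n. m \<noteq> n \<Longrightarrow> T m \<inter> T n = {}"
    and s: "\<And>m x y. \<lbrakk>x \<in> T m; y \<in> T m\<rbrakk> \<Longrightarrow> dist x y \<le> s m" and s0: "s \<longlonglongrightarrow> 0"
    and C: "closed C" "C \<subseteq> X" and h: "continuous_on C h" "h ` C \<subseteq> {a..b}" "a \<le> b"
    and hT: "\<And>m x y. \<lbrakk>m \<in> J; x \<in> C \<inter> T m; y \<in> C \<inter> T m\<rbrakk> \<Longrightarrow> h x = h y"
  shows "\<exists>F. continuous_on X F \<and> (\<forall>x\<in>C. F x = h x) \<and> F ` X \<subseteq> {a..b} \<and>
    (\<forall>m\<in>J. \<forall>x\<in>T m. \<forall>y\<in>T m. F x = F y)"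
proof -
  \<comment> \<open>\<open>q x\<close> is the equivalence class of \<open>x\<close> as a set:
    \<open>T m\<close> for \<open>x\<close> in some \<open>T m\<close> with
    \<open>m \<in> J\<close>, and \<open>{x}\<close> otherwise.\<close>
  define q where "q = (\<lambda>x. insert x (\<Union>m\<in>{m \<in> J. x \<in> T m}. T m))"
  have qT: "q x = T m" if "m \<in> J" "x \<in> T m" for m x
  proof -
    have "{m \<in> J. x \<in> T m} = {m}" using that disj by blast
    then show ?thesis using that by (auto simp: q_def)
  qed
  have q1: "q x = {x}" if "\<And>m. m \<in> J \<Longrightarrow> x \<notin> T m" for x
    using that by (auto simp: q_def)
  have qeq: "x = y \<or> (\<exists>m\<in>J. x \<in> T m \<and> y \<in> T m)" if "q x = q y" for x y
  proof -
    have "x \<in> q y" using that[symmetric] by (simp add: q_def)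
    then show ?thesis by (auto simp: q_def)
  qed
  have h_q: "h x = h y" if "x \<in> C" "y \<in> C" "q x = q y" for x y
    using qeq[OF that(3)] hT that by blast
  obtain Y where Y: "quotient_map (top_of_set X) Y q" by (rule exists_quotient_map)
  have contq: "continuous_map (top_of_set X) Y q" and surj: "q ` X = topspace Y"
    using quotient_imp_continuous_map[OF Y] quotient_imp_surjective_map[OF Y] by auto
  have closedq: "closed_map (top_of_set X) Y q"
    unfolding closed_map_def
  proof (intro allI impI)
    fix A assume "closedin (top_of_set X) A"
    then have A: "closed A" "A \<subseteq> X" using X closedin_closed_eq by blast+
    have eq: "{x \<in> X. q x \<in> q ` A} = A \<union> (\<Union>m\<in>{m \<in> J. T m \<inter> A \<noteq> {}}. T m)"
    proof (intro equalityI subsetI)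
      fix x assume "x \<in> {x \<in> X. q x \<in> q ` A}"
      then obtain y where "y \<in> A" "q x = q y" by blast
      then show "x \<in> A \<union> (\<Union>m\<in>{m \<in> J. T m \<inter> A \<noteq> {}}. T m)" using qeq[of x y] by blast
    next
      fix x assume "x \<in> A \<union> (\<Union>m\<in>{m \<in> J. T m \<inter> A \<noteq> {}}. T m)"
      then consider "x \<in> A" | m y where "m \<in> J" "x \<in> T m" "y \<in> T m" "y \<in> A" by blast
      then show "x \<in> {x \<in> X. q x \<in> q ` A}"
      proof cases
        case 2
        then have "q x = q y" using qT by simp
        then show ?thesis using 2 T(2) by blast
      qed (use A in blast)
    qed
    have "closed (A \<union> (\<Union>m\<in>{m \<in> J. T m \<inter> A \<noteq> {}}. T m))"
      by (rule closed_null_saturation[where T = T and s = s, OF A(1) T(1) _ s s0]) auto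
    then have "closed {x \<in> X. q x \<in> q ` A}" by (simp only: eq)
    then have "closedin (top_of_set X) {x \<in> X. q x \<in> q ` A}"
      unfolding closedin_closed_eq[OF X] by blast
    moreover have "q ` A \<subseteq> topspace Y" using A surj by blast
    ultimately show "closedin Y (q ` A)"
      using Y unfolding quotient_map_closedin by auto
  qed
  have "normal_space (top_of_set X)"
    by (intro metrizable_imp_normal_space metrizable_space_subtopology metrizable_space_euclidean)
  then have nY: "normal_space Y"
    by (rule normal_space_continuous_closed_map_image[OF _ contq closedq]) (simp add: surj)
  \<comment> \<open>\<open>k\<close> is \<open>h\<close> transported to the quotient. By
    \<open>h_q\<close> the chosen representative is immaterial.\<close>
  define k where "k = (\<lambda>y. h (SOME x. x \<in> C \<and> q x = y))"
  have k: "k (q x) = h x" if "x \<in> C" for x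
  proof -
    have "\<exists>x'. x' \<in> C \<and> q x' = q x" using that by blast
    from someI_ex[OF this] show ?thesis unfolding k_def by (intro h_q that) auto
  qed
  have closedqA: "closedin Y (q ` A)" if "closed A" "A \<subseteq> X" for A
    using closedq that closedin_closed_eq[OF X] unfolding closed_map_def by blast
  have "continuous_map (subtopology Y (q ` C)) euclideanreal k"
    unfolding continuous_map_closedin
  proof (intro conjI allI impI)
    fix B :: "real set" assume "closedin euclidean B"
    then have "closed B" by simp
    have eq: "{y \<in> topspace (subtopology Y (q ` C)). k y \<in> B} = q ` (C \<inter> h -` B)"
    proof (intro equalityI subsetI)
      fix y assume "y \<in> {y \<in> topspace (subtopology Y (q ` C)). k y \<in> B}"
      then obtain x where "x \<in> C" "y = q x" "k y \<in> B" by auto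
      then show "y \<in> q ` (C \<inter> h -` B)" using k by auto
    next
      fix y assume "y \<in> q ` (C \<inter> h -` B)"
      then obtain x where "x \<in> C" "h x \<in> B" "y = q x" by auto
      then show "y \<in> {y \<in> topspace (subtopology Y (q ` C)). k y \<in> B}" using k surj C(2) by auto
    qed
    have "closed (C \<inter> h -` B)"
      using continuous_closed_preimage[OF h(1) C(1) \<open>closed B\<close>] .
    then have "closedin Y (q ` (C \<inter> h -` B))" using C by (intro closedqA) auto
    then show "closedin (subtopology Y (q ` C)) {y \<in> topspace (subtopology Y (q ` C)). k y \<in> B}"
      unfolding eq by (rule closedin_subset_topspace) auto
  qed auto
  then obtain g where g: "continuous_map Y euclideanreal g" "\<And>y. y \<in> q ` C \<Longrightarrow> g y = k y" "g ` topspace Y \<subseteq> {a..b}"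
  proof (rule Tietze_extension_closed_real_interval[OF nY closedqA[OF C]])
    show "k ` q ` C \<subseteq> {a..b}" using h(2) k by (auto simp: image_subset_iff)
  qed (use h(3) in auto)
  show ?thesis
  proof (intro exI[of _ "g \<circ> q"] conjI ballI)
    show "continuous_on X (g \<circ> q)"
      using continuous_map_compose[OF contq g(1)] by simp
    show "(g \<circ> q) x = h x" if "x \<in> C" for x using g(2) k that by simp
    show "(g \<circ> q) ` X \<subseteq> {a..b}" using g(3) surj by auto
    show "(g \<circ> q) x = (g \<circ> q) y" if "m \<in> J" "x \<in> T m" "y \<in> T m" for m x y
      using qT[OF that(1)] that by simp
  qed
qed

text \<open>Real and imaginary parts are extended separately; compactness supplies the bounded
  interval required by the real version.\<close>

lemma Tietze_collapsed_complex:
  fixes X :: "'a::metric_space set" and T :: "nat \<Rightarrow> 'a set" and h :: "'a \<Rightarrow> complex"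
  assumes X: "compact X" and T: "\<And>m. closed (T m)" "\<And>m. T m \<subseteq> X"
    and disj: "\<And>m n. m \<noteq> n \<Longrightarrow> T m \<inter> T n = {}"
    and s: "\<And>m x y. \<lbrakk>x \<in> T m; y \<in> T m\<rbrakk> \<Longrightarrow> dist x y \<le> s m" and s0: "s \<longlonglongrightarrow> 0"
    and C: "closed C" "C \<subseteq> X" and h: "continuous_on C h"
    and hT: "\<And>m x y. \<lbrakk>m \<in> J; x \<in> C \<inter> T m; y \<in> C \<inter> T m\<rbrakk> \<Longrightarrow> h x = h y"
  shows "\<exists>F. continuous_on X F \<and> (\<forall>x\<in>C. F x = h x) \<and> (\<forall>m\<in>J. \<forall>x\<in>T m. \<forall>y\<in>T m. F x = F y)"
proof -
  have "compact C" using X C by (metis compact_Int_closed inf.absorb_iff2)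
  then obtain M where M: "\<And>x. x \<in> C \<Longrightarrow> norm (h x) \<le> M"
    using compact_imp_bounded[OF compact_continuous_image[OF h]] by (auto simp: bounded_iff)
  have M': "\<bar>Re (h x)\<bar> \<le> \<bar>M\<bar>" "\<bar>Im (h x)\<bar> \<le> \<bar>M\<bar>" if "x \<in> C" for x
    using M[OF that] abs_Re_le_cmod[of "h x"] abs_Im_le_cmod[of "h x"] by linarith+
  have R: "continuous_on C (\<lambda>x. Re (h x))" "(\<lambda>x. Re (h x)) ` C \<subseteq> {- \<bar>M\<bar>..\<bar>M\<bar>}"
    "continuous_on C (\<lambda>x. Im (h x))" "(\<lambda>x. Im (h x)) ` C \<subseteq> {- \<bar>M\<bar>..\<bar>M\<bar>}"
    using M' by (fastforce intro!: continuous_intros h simp: abs_le_iff)+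
  have hT': "Re (h x) = Re (h y)" "Im (h x) = Im (h y)" if "m \<in> J" "x \<in> C \<inter> T m" "y \<in> C \<inter> T m" for m x y
    using hT[OF that] by simp_all
  have M0: "- \<bar>M\<bar> \<le> \<bar>M\<bar>" by simp
  have "\<exists>F. continuous_on X F \<and> (\<forall>x\<in>C. F x = Re (h x)) \<and> F ` X \<subseteq> {- \<bar>M\<bar>..\<bar>M\<bar>} \<and>
      (\<forall>m\<in>J. \<forall>x\<in>T m. \<forall>y\<in>T m. F x = F y)"
    by (rule Tietze_collapsed_real[where T = T and s = s])
      (fact compact_imp_closed[OF X] T disj s s0 C R M0 hT')+
  then obtain F where F: "continuous_on X F" "\<forall>x\<in>C. F x = Re (h x)" "\<forall>m\<in>J. \<forall>x\<in>T m. \<forall>y\<in>T m. F x = F y"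
    by blast
  have "\<exists>G. continuous_on X G \<and> (\<forall>x\<in>C. G x = Im (h x)) \<and> G ` X \<subseteq> {- \<bar>M\<bar>..\<bar>M\<bar>} \<and>
      (\<forall>m\<in>J. \<forall>x\<in>T m. \<forall>y\<in>T m. G x = G y)"
    by (rule Tietze_collapsed_real[where T = T and s = s])
      (fact compact_imp_closed[OF X] T disj s s0 C R M0 hT')+
  then obtain G where G: "continuous_on X G" "\<forall>x\<in>C. G x = Im (h x)" "\<forall>m\<in>J. \<forall>x\<in>T m. \<forall>y\<in>T m. G x = G y"
    by blast
  show ?thesis
  proof (intro exI[of _ "\<lambda>x. Complex (F x) (G x)"] conjI ballI)
    show "continuous_on X (\<lambda>x. Complex (F x) (G x))"
      unfolding Complex_eq by (intro continuous_intros F G)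
    show "Complex (F x) (G x) = h x" if "x \<in> C" for x
      using F(2) G(2) that by simp
    show "Complex (F x) (G x) = Complex (F y) (G y)" if "m \<in> J" "x \<in> T m" "y \<in> T m" for m x y
      using F(3) G(3) that by blast
  qed
qed

section \<open>Disjoint copies of the Swiss cheese\<close>

definition copy :: "complex set \<Rightarrow> complex \<times> real \<Rightarrow> complex set" where
  "copy K d = (\<lambda>z. fst d + of_real (snd d) * z) ` K"

lemma compact_copy: "compact K \<Longrightarrow> compact (copy K d)"
  unfolding copy_def by (intro compact_continuous_image continuous_intros)

lemma copy_subset_cball:
  assumes "K \<subseteq> cball 0 2" "0 < snd d"
  shows "copy K d \<subseteq> cball (fst d) (2 * snd d)"
proof
  fix w assume "w \<in> copy K d"
  then obtain z where z: "z \<in> K" "w = fst d + of_real (snd d) * z" by (auto simp: copy_def)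
  then have "norm z \<le> 2" using assms by auto
  then have "snd d * norm z \<le> snd d * 2" using assms by (intro mult_left_mono) auto
  then show "w \<in> cball (fst d) (2 * snd d)"
    using assms z by (simp add: dist_norm norm_mult)
qed

text \<open>The preimage of the interior under the affine map is an open subset of
  \<open>K\<close>.\<close>

lemma interior_copy:
  assumes K: "interior K = {}" and d: "0 < snd d"
  shows "interior (copy K d) = {}"
proof (rule ccontr)
  define g where "g = (\<lambda>z. fst d + of_real (snd d) * z)"
  assume "interior (copy K d) \<noteq> {}"
  then obtain w where w: "w \<in> interior (copy K d)" by blast
  then obtain z where z: "z \<in> K" "w = g z"
    using interior_subset[of "copy K d"] by (auto simp: copy_def g_def)
  have "open (g -` interior (copy K d))"
    unfolding g_def by (intro open_vimage continuous_intros) auto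
  moreover have "g -` interior (copy K d) \<subseteq> K"
  proof
    fix y assume "y \<in> g -` interior (copy K d)"
    then have "g y \<in> copy K d" using interior_subset by blast
    then obtain z where "z \<in> K" "g y = g z" by (auto simp: copy_def g_def)
    then show "y \<in> K" using d by (simp add: g_def)
  qed
  moreover have "z \<in> g -` interior (copy K d)" using w z by simp
  ultimately show False using K interior_maximal by blast
qed

lemma interior_finite_UN_closed_empty:
  fixes T :: "nat \<Rightarrow> 'a::topological_space set"
  assumes "\<And>m. m < n \<Longrightarrow> closed (T m)" "\<And>m. m < n \<Longrightarrow> interior (T m) = {}"
  shows "interior (\<Union>m<n. T m) = {}"
  using assms
proof (induction n)
  case (Suc n)
  have "interior (T n \<union> (\<Union>m<n. T m)) = interior (T n)"
    using Suc by (intro interior_closed_Un_empty_interior) auto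
  then show ?case using Suc.prems(2)[of n] by (simp add: lessThan_Suc)
qed simp

text \<open>The copies are chosen recursively along an enumerated base. Finitely many earlier copies
  form a closed set without interior, so the next basic set still contains a small ball in the open
  disc that avoids them all.\<close>

lemma disjoint_copies:
  assumes K: "compact K" "K \<subseteq> cball 0 2" "interior K = {}"
  obtains f :: "nat \<Rightarrow> complex \<times> real"
  where "\<And>n. 0 < snd (f n)" "\<And>n. snd (f n) \<le> inverse (real (Suc n))"
    and "\<And>n. copy K (f n) \<subseteq> cball 0 1"
    and "\<And>m n. m \<noteq> n \<Longrightarrow> copy K (f m) \<inter> copy K (f n) = {}"
    and "\<And>V. \<lbrakk>open V; V \<inter> cball 0 1 \<noteq> {}\<rbrakk> \<Longrightarrow> \<exists>n. copy K (f n) \<subseteq> V"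
proof -
  obtain B :: "complex set set" where B: "countable B" "\<And>C. C \<in> B \<Longrightarrow> open C"
    "\<And>S. open S \<Longrightarrow> \<exists>U. U \<subseteq> B \<and> S = \<Union>U"
    using univ_second_countable by blast
  \<comment> \<open>Only basic sets meeting the open disc are used. They suffice, since an open set
    meeting the closed disc also meets its interior.\<close>
  define B' where "B' = {b \<in> B. b \<inter> ball 0 1 \<noteq> {}}"
  have small: "\<exists>b\<in>B'. b \<subseteq> V" if V: "open V" "V \<inter> cball 0 1 \<noteq> {}" for V
  proof -
    have "V \<inter> ball 0 1 \<noteq> {}"
      using V open_Int_closure_eq_empty[of V "ball 0 1"] by simp
    then obtain x where x: "x \<in> V" "x \<in> ball 0 1" by blast
    obtain U where U: "U \<subseteq> B" "V = \<Union>U" using B(3)[OF V(1)] by blast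
    then obtain b where b: "b \<in> U" "x \<in> b" using x by blast
    then have "b \<in> B'" using U x unfolding B'_def by blast
    then show ?thesis using U b by blast
  qed
  have B'0: "B' \<noteq> {}" using small[of UNIV] by auto
  have cB': "countable B'" using B(1) by (simp add: B'_def)
  define U where "U = from_nat_into B'"
  have U: "open (U n)" "U n \<inter> ball 0 1 \<noteq> {}" for n
    using from_nat_into[OF B'0, of n] B(2) by (auto simp: U_def B'_def)
  \<comment> \<open>The ball has radius \<open>2 * snd d\<close> because \<open>K\<close> lies in
    \<open>cball 0 2\<close>; the bound on \<open>snd d\<close> makes the diameters tend to
    0.\<close>
  define P where "P = (\<lambda>(f::nat \<Rightarrow> complex \<times> real) n d. 0 < snd d \<and> snd d \<le> inverse (real (Suc n)) \<and>
    cball (fst d) (2 * snd d) \<subseteq> U n \<inter> ball 0 1 - (\<Union>m<n. copy K (f m)))"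
  have "\<exists>f. \<forall>n. P f n (f n)"
  \<comment> \<open>\<open>P f n\<close> refers to \<open>f\<close> only at indices below
    \<open>n\<close>, which is what the choice principle asks for.\<close>
  proof (rule dependent_wellorder_choice)
    fix r f g and x :: nat assume "\<And>y. y < x \<Longrightarrow> f y = (g y :: complex \<times> real)"
    then have "(\<Union>m<x. copy K (f m)) = (\<Union>m<x. copy K (g m))" by simp
    then show "P f x r = P g x r" by (simp add: P_def)
  next
    fix n f assume IH: "\<And>y. y < n \<Longrightarrow> P f y (f y)"
    let ?S = "\<Union>m<n. copy K (f m)"
    have cl: "closed (copy K d)" for d using compact_copy[OF K(1)] compact_imp_closed by blast
    have "interior ?S = {}"
      using IH by (intro interior_finite_UN_closed_empty cl interior_copy K(3)) (auto simp: P_def)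
    moreover have "closed ?S" by (intro closed_UN ballI cl) simp
    then have op: "open (U n \<inter> ball 0 1 - ?S)" using U(1) by (intro open_Diff) auto
    have "U n \<inter> ball 0 1 - ?S \<noteq> {}"
    proof
      assume "U n \<inter> ball 0 1 - ?S = {}"
      then have "U n \<inter> ball 0 1 \<subseteq> interior ?S" using U(1) by (intro interior_maximal) auto
      then show False using \<open>interior ?S = {}\<close> U(2) by blast
    qed
    then obtain a where "a \<in> U n \<inter> ball 0 1 - ?S" by blast
    then obtain e where e: "0 < e" "cball a e \<subseteq> U n \<inter> ball 0 1 - ?S"
      using op[unfolded open_contains_cball] by blast
    define \<rho> where "\<rho> = min (e / 2) (inverse (real (Suc n)))"
    have "cball a (2 * \<rho>) \<subseteq> cball a e" by (rule subset_cball) (simp add: \<rho>_def)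
    then have "P f n (a, \<rho>)" using e unfolding P_def by (auto simp: \<rho>_def)
    then show "\<exists>r. P f n r" ..
  qed
  then obtain f where f: "\<And>n. P f n (f n)" by blast
  have sub: "copy K (f n) \<subseteq> U n \<inter> ball 0 1 - (\<Union>m<n. copy K (f m))" for n
    using copy_subset_cball[OF K(2), of "f n"] f[of n] unfolding P_def by blast
  show thesis
  proof (rule that[of f])
    show "0 < snd (f n)" "snd (f n) \<le> inverse (real (Suc n))" for n using f[of n] by (auto simp: P_def)
    show "copy K (f n) \<subseteq> cball 0 1" for n using sub[of n] ball_subset_cball by blast
    show "copy K (f m) \<inter> copy K (f n) = {}" if "m \<noteq> n" for m n
      using that
    proof (induction m n rule: linorder_wlog)
      case (le m n)
      then show ?case using sub[of n] by force
    qed blast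
    show "\<exists>n. copy K (f n) \<subseteq> V" if V: "open V" "V \<inter> cball 0 1 \<noteq> {}" for V
    proof -
      obtain b where b: "b \<in> B'" "b \<subseteq> V" using small[OF V] by blast
      then obtain n where "U n = b" unfolding U_def using from_nat_into_surj[OF cB'] by blast
      then show ?thesis using sub[of n] b by blast
    qed
  qed
qed

section \<open>The glued algebra\<close>

lemma (in function_algebra) character_sum:
  assumes \<phi>: "character K S \<phi>" and f: "\<And>i. i \<in> I \<Longrightarrow> f i \<in> S"
  shows "\<phi> (\<lambda>x. \<Sum>i\<in>I. f i x) = (\<Sum>i\<in>I. \<phi> (f i))"
  using f
proof (induction I rule: infinite_finite_induct)
  case (insert i I)
  then show ?case
    by (simp add: characterD(1)[OF \<phi> insert.prems(1)[of i] sum[of I f]])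
qed (simp_all add: characterD(3)[OF \<phi>])

locale swiss_cheese_copies =
  fixes K :: "complex set" and d :: "nat \<Rightarrow> complex \<times> real" and X :: "complex set"
  assumes X: "compact X" and K: "compact K" "K \<subseteq> cball 0 2"
    and nontrivial: "cnj \<notin> R_alg K"
    and regular: "\<And>x C. \<lbrakk>x \<in> K; closed C; x \<notin> C\<rbrakk> \<Longrightarrow> \<exists>f\<in>R_alg K. f x = 1 \<and> (\<forall>z\<in>K \<inter> C. f z = 0)"
    and d: "\<And>n. 0 < snd (d n)" "\<And>n. snd (d n) \<le> inverse (real (Suc n))"
    and sub: "\<And>n. copy K (d n) \<subseteq> X"
    and disj: "\<And>m n. m \<noteq> n \<Longrightarrow> copy K (d m) \<inter> copy K (d n) = {}"
    and dense: "\<And>V. \<lbrakk>open V; V \<inter> X \<noteq> {}\<rbrakk> \<Longrightarrow> \<exists>n. copy K (d n) \<subseteq> V"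
begin

definition emb :: "nat \<Rightarrow> complex \<Rightarrow> complex" where
  "emb n z = fst (d n) + of_real (snd (d n)) * z"

abbreviation T :: "nat \<Rightarrow> complex set" where "T n \<equiv> copy K (d n)"

lemma T_eq: "T n = emb n ` K"
  by (simp add: copy_def emb_def)

lemma continuous_on_emb: "continuous_on A (emb n)"
  unfolding emb_def by (intro continuous_intros)

definition emb_inv :: "nat \<Rightarrow> complex \<Rightarrow> complex" where
  "emb_inv n w = (w - fst (d n)) / of_real (snd (d n))"

lemma emb_inv [simp]: "emb_inv n (emb n z) = z"
  using d(1)[of n] by (simp add: emb_def emb_inv_def)

lemma emb_inv_T: "w \<in> T n \<Longrightarrow> emb_inv n w \<in> K"
  by (auto simp: T_eq)

lemma continuous_on_emb_inv: "continuous_on A (emb_inv n)"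
  unfolding emb_inv_def using d(1)[of n] by (intro continuous_intros) auto

lemma closed_T: "closed (T n)"
  by (intro compact_imp_closed compact_copy K)

lemma dist_copy:
  assumes "x \<in> T m" "y \<in> T m"
  shows "dist x y \<le> 4 * inverse (real (Suc m))"
proof -
  have "x \<in> cball (fst (d m)) (2 * snd (d m))" "y \<in> cball (fst (d m)) (2 * snd (d m))"
    using copy_subset_cball[OF K(2) d(1)] assms by blast+
  then have "dist x y \<le> 2 * snd (d m) + 2 * snd (d m)"
    using dist_triangle2[of x y "fst (d m)"] by (simp add: dist_commute)
  also have "\<dots> \<le> 4 * inverse (real (Suc m))" using d(2)[of m] by simp
  finally show ?thesis .
qed

lemma diameters_tendsto_0: "(\<lambda>m. 4 * inverse (real (Suc m))) \<longlonglongrightarrow> 0"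
  using tendsto_mult_right_zero[OF LIMSEQ_inverse_real_of_nat] by blast

text \<open>\<open>J\<close> indexes the copies to be collapsed; leaving an index out permits a
  non-constant \<open>h\<close> on that copy.\<close>

lemma extend:
  assumes C: "closed C" "C \<subseteq> X" and h: "continuous_on C h"
    and hT: "\<And>m x y. \<lbrakk>m \<in> J; x \<in> C \<inter> T m; y \<in> C \<inter> T m\<rbrakk> \<Longrightarrow> h x = (h y :: complex)"
  obtains F where "continuous_on X F" "\<And>x. x \<in> C \<Longrightarrow> F x = h x"
    "\<And>m x y. \<lbrakk>m \<in> J; x \<in> T m; y \<in> T m\<rbrakk> \<Longrightarrow> F x = F y"
proof -
  have "\<exists>F. continuous_on X F \<and> (\<forall>x\<in>C. F x = h x) \<and> (\<forall>m\<in>J. \<forall>x\<in>T m. \<forall>y\<in>T m. F x = F y)"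
    by (rule Tietze_collapsed_complex[where T = T and s = "\<lambda>m. 4 * inverse (real (Suc m))"])
      (fact X closed_T sub disj dist_copy diameters_tendsto_0 C h hT)+
  then show thesis using that by blast
qed

text \<open>This version keeps the range in an interval, as needed for the cutoff in
  \<open>character_vanishing\<close>.\<close>

lemma extend_real:
  assumes C: "closed C" "C \<subseteq> X" and h: "continuous_on C h" "h ` C \<subseteq> {a..b}" "a \<le> b"
    and hT: "\<And>m x y. \<lbrakk>m \<in> J; x \<in> C \<inter> T m; y \<in> C \<inter> T m\<rbrakk> \<Longrightarrow> h x = (h y :: real)"
  obtains F where "continuous_on X F" "\<And>x. x \<in> C \<Longrightarrow> F x = h x" "F ` X \<subseteq> {a..b}"
    "\<And>m x y. \<lbrakk>m \<in> J; x \<in> T m; y \<in> T m\<rbrakk> \<Longrightarrow> F x = F y"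
proof -
  have "\<exists>F. continuous_on X F \<and> (\<forall>x\<in>C. F x = h x) \<and> F ` X \<subseteq> {a..b} \<and>
      (\<forall>m\<in>J. \<forall>x\<in>T m. \<forall>y\<in>T m. F x = F y)"
    by (rule Tietze_collapsed_real[where T = T and s = "\<lambda>m. 4 * inverse (real (Suc m))"])
      (fact compact_imp_closed[OF X] closed_T sub disj dist_copy diameters_tendsto_0 C h hT)+
  then obtain F where F: "continuous_on X F" "\<forall>x\<in>C. F x = h x" "F ` X \<subseteq> {a..b}"
    "\<forall>m\<in>J. \<forall>x\<in>T m. \<forall>y\<in>T m. F x = F y"
    by (elim exE conjE)
  show thesis by (rule that[OF F(1) _ F(3)]) (use F(2,4) in blast)+
qed

text \<open>The condition on each copy is pulled back along \<open>emb n\<close>, so that only the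
  one algebra \<open>R_alg K\<close> occurs.\<close>

definition B :: "(complex \<Rightarrow> complex) set" where
  "B = {f. continuous_on X f \<and> (\<forall>n. (\<lambda>z. f (emb n z)) \<in> R_alg K)}"

text \<open>\<open>G\<close> plays the role of \<open>C(Y)\<close>, where \<open>Y\<close> is \<open>X\<close> with every \<open>T n\<close> collapsed to a point.\<close>

definition G :: "(complex \<Rightarrow> complex) set" where
  "G = {f. continuous_on X f \<and> (\<forall>n. \<forall>x\<in>T n. \<forall>y\<in>T n. f x = f y)}"

section \<open>Closure properties, regularity and essentiality of \<open>B\<close>\<close>

lemma function_algebra_R: "function_algebra K (R_alg K)"
  using K(1) by (rule function_algebra_R_alg)

lemma const_on_T:
  assumes "\<And>x y. \<lbrakk>x \<in> T n; y \<in> T n\<rbrakk> \<Longrightarrow> f x = f y"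
  shows "(\<lambda>z. f (emb n z)) \<in> R_alg K"
proof -
  interpret R: function_algebra K "R_alg K" by (rule function_algebra_R)
  show ?thesis
  proof (cases "K = {}")
    case True
    then show ?thesis by (intro R.cong_on[OF R.const[of 0]]) auto
  next
    case False
    then obtain z0 where "z0 \<in> K" by blast
    then show ?thesis
      by (intro R.cong_on[OF R.const[of "f (emb n z0)"]] assms) (auto simp: T_eq)
  qed
qed

lemma G_subset_B: "G \<subseteq> B"
  unfolding B_def G_def by (auto intro!: const_on_T)

lemma function_algebra_B: "function_algebra X B"
proof -
  interpret R: function_algebra K "R_alg K" by (rule function_algebra_R)
  show ?thesis
  proof
    show "(\<lambda>_. c) \<in> B" for c by (auto simp: B_def intro: R.const)
    show "(\<lambda>x. f x + g x) \<in> B" if "f \<in> B" "g \<in> B" for f g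
      using that by (auto simp: B_def intro!: continuous_intros R.add)
    show "(\<lambda>x. f x * g x) \<in> B" if "f \<in> B" "g \<in> B" for f g
      using that by (auto simp: B_def intro!: continuous_intros R.mult)
    fix f assume *: "\<And>e. 0 < e \<Longrightarrow> \<exists>g\<in>B. \<forall>x\<in>X. norm (f x - g x) < e"
    have "\<exists>g. g \<in> B \<and> (\<forall>x\<in>X. norm (f x - g x) < inverse (real (Suc n)))" for n
      using *[of "inverse (real (Suc n))"] by auto
    then obtain g where g: "\<And>n. g n \<in> B" "\<And>n x. x \<in> X \<Longrightarrow> norm (f x - g n x) < inverse (real (Suc n))"
      by metis
    have "uniform_limit X g f sequentially"
      unfolding uniform_limit_iff
    proof (intro allI impI)
      fix e :: real assume "0 < e"
      have "\<forall>\<^sub>F n in sequentially. inverse (real (Suc n)) < e"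
        using LIMSEQ_inverse_real_of_nat \<open>0 < e\<close> by (rule order_tendstoD)
      then show "\<forall>\<^sub>F n in sequentially. \<forall>x\<in>X. dist (g n x) (f x) < e"
      proof eventually_elim
        case (elim n)
        show ?case
        proof
          fix x assume "x \<in> X"
          then show "dist (g n x) (f x) < e"
            using g(2)[of x n] elim by (simp add: dist_norm norm_minus_commute)
        qed
      qed
    qed
    then have "continuous_on X f"
      by (rule uniform_limit_theorem[rotated]) (use g(1) in \<open>auto simp: B_def\<close>)
    moreover have "(\<lambda>z. f (emb n z)) \<in> R_alg K" for n
    proof (rule R.lim)
      fix e :: real assume "0 < e"
      then obtain g where g: "g \<in> B" "\<forall>x\<in>X. norm (f x - g x) < e" using * by blast
      then show "\<exists>g\<in>R_alg K. \<forall>z\<in>K. norm (f (emb n z) - g z) < e"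
        using sub[of n] by (intro bexI[of _ "\<lambda>z. g (emb n z)"]) (auto simp: B_def T_eq)
    qed
    ultimately show "f \<in> B" by (simp add: B_def)
  qed
qed

text \<open>The copy of \<open>r\<close> on \<open>T n\<close> is glued with 0 on \<open>C\<close>
  and extended so as to be constant on every other copy; constants belong to \<open>R_alg K\<close>,
  so the extension is in \<open>B\<close>.\<close>

lemma extend_R_alg:
  assumes r: "r \<in> R_alg K" and C: "closed C" "C \<subseteq> X"
    and rC: "\<And>z. z \<in> K \<Longrightarrow> emb n z \<in> C \<Longrightarrow> r z = 0"
  obtains F where "F \<in> B" "\<And>z. z \<in> K \<Longrightarrow> F (emb n z) = r z" "\<And>x. x \<in> C \<Longrightarrow> F x = 0"
proof -
  define h where "h = (\<lambda>x. if x \<in> T n then r (emb_inv n x) else 0)"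
  have hC: "h x = 0" if "x \<in> C" for x
    using that rC by (auto simp: h_def T_eq)
  have "continuous_on (T n \<union> C) h"
  proof (rule continuous_on_closed_Un[OF closed_T C(1)])
    have "continuous_on (T n) (\<lambda>x. r (emb_inv n x))"
      by (rule continuous_on_compose2[OF continuous_on_R_alg[OF r] continuous_on_emb_inv]) (auto intro: emb_inv_T)
    then show "continuous_on (T n) h"
      by (rule continuous_on_eq) (simp add: h_def)
    show "continuous_on C h"
      by (rule continuous_on_eq[OF continuous_on_const[of _ 0]]) (simp add: hC)
  qed
  moreover have "closed (T n \<union> C)" "T n \<union> C \<subseteq> X" using closed_T C sub by auto
  \<comment> \<open>By disjointness, a point of \<open>T m\<close> with \<open>m\<close> different
    from \<open>n\<close> can only come from \<open>C\<close>, where \<open>h\<close> is 0.\<close>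
  moreover have "h x = h y" if "m \<in> - {n}" "x \<in> (T n \<union> C) \<inter> T m" "y \<in> (T n \<union> C) \<inter> T m" for m x y
    using that disj[of m n] hC by (metis Compl_iff IntE UnE disjoint_iff singletonI)
  ultimately obtain F where F: "continuous_on X F" "\<And>x. x \<in> T n \<union> C \<Longrightarrow> F x = h x"
    "\<And>m x y. \<lbrakk>m \<in> - {n}; x \<in> T m; y \<in> T m\<rbrakk> \<Longrightarrow> F x = F y"
    using extend[of "T n \<union> C" h "- {n}"] by blast
  interpret R: function_algebra K "R_alg K" by (rule function_algebra_R)
  have Fr: "F (emb n z) = r z" if "z \<in> K" for z
    using that F(2)[of "emb n z"] by (simp add: h_def T_eq)
  have "(\<lambda>z. F (emb m z)) \<in> R_alg K" for m
  proof (cases "m = n")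
    case True
    then show ?thesis using R.cong_on[OF r, of "\<lambda>z. F (emb n z)"] Fr by simp
  next
    case False
    then have "m \<in> - {n}" by simp
    then show ?thesis by (intro const_on_T F(3))
  qed
  then have "F \<in> B" using F(1) by (simp add: B_def)
  then show thesis using that Fr F(2) hC by auto
qed

text \<open>On a copy, regularity of \<open>R_alg K\<close> provides the function and
  \<open>extend_R_alg\<close> spreads it over \<open>X\<close>. A point outside all copies is
  separated from \<open>C\<close> even by a function in \<open>G\<close>.\<close>

lemma B_regular:
  assumes C: "closed C" "C \<subseteq> X" and x: "x \<in> X" "x \<notin> C"
  obtains F where "F \<in> B" "F x = 1" "\<And>y. y \<in> C \<Longrightarrow> F y = 0"
proof (cases "\<exists>n. x \<in> T n")
  case True
  then obtain n z where z: "z \<in> K" "x = emb n z" by (auto simp: T_eq)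
  have "closed (emb n -` C)" using C(1) continuous_on_emb by (intro closed_vimage) auto
  moreover have "z \<notin> emb n -` C" using x z by simp
  ultimately obtain r where r: "r \<in> R_alg K" "r z = 1" "\<forall>z\<in>K \<inter> emb n -` C. r z = 0"
    using regular[OF z(1)] by blast
  obtain F where "F \<in> B" "\<And>z. z \<in> K \<Longrightarrow> F (emb n z) = r z" "\<And>x. x \<in> C \<Longrightarrow> F x = 0"
    by (rule extend_R_alg[OF r(1) C, of n]) (use r(3) in auto)
  then show thesis using that[of F] r z by simp
next
  case False
  define h where "h = (\<lambda>y. if y = x then 1 else 0 :: complex)"
  have "continuous_on ({x} \<union> C) h"
  proof (rule continuous_on_closed_Un[OF _ C(1)])
    show "continuous_on C h"
      by (rule continuous_on_eq[OF continuous_on_const[of _ 0]]) (use x in \<open>auto simp: h_def\<close>)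
  qed auto
  moreover have "closed ({x} \<union> C)" "{x} \<union> C \<subseteq> X" using C x by auto
  moreover have "h y = h y'" if "m \<in> UNIV" "y \<in> ({x} \<union> C) \<inter> T m" "y' \<in> ({x} \<union> C) \<inter> T m" for m y y'
    using that False by (auto simp: h_def)
  ultimately obtain F where F: "continuous_on X F" "\<And>y. y \<in> {x} \<union> C \<Longrightarrow> F y = h y"
    "\<And>m y y'. \<lbrakk>m \<in> UNIV; y \<in> T m; y' \<in> T m\<rbrakk> \<Longrightarrow> F y = F y'"
    using extend[of "{x} \<union> C" h UNIV] by blast
  have "F \<in> G" unfolding G_def using F(1) F(3)[OF UNIV_I] by blast
  then have "F \<in> B" using G_subset_B by blast
  moreover have "F x = 1" using F(2)[of x] by (simp add: h_def)
  moreover have "F y = 0" if "y \<in> C" for y using F(2)[of y] that x by (auto simp: h_def)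
  ultimately show thesis by (rule that)
qed

text \<open>By \<open>dense\<close> a whole copy lies in \<open>V\<close>. A continuous function
  that is conjugation on this copy and 0 off \<open>V\<close> is not in \<open>B\<close>, because
  \<open>cnj\<close> is not in \<open>R_alg K\<close>.\<close>

lemma B_essential:
  assumes V: "open V" "V \<inter> X \<noteq> {}"
  obtains F where "continuous_on X F" "F \<notin> B" "\<And>y. y \<in> X - V \<Longrightarrow> F y = 0"
proof -
  obtain n where n: "T n \<subseteq> V" using dense[OF V] by blast
  define h where "h = (\<lambda>x. if x \<in> T n then cnj (emb_inv n x) else 0)"
  have cl: "closed (X - V)" using V X compact_imp_closed by blast
  have ch: "continuous_on (T n \<union> (X - V)) h"
  proof (rule continuous_on_closed_Un[OF closed_T cl])
    have "continuous_on (T n) (\<lambda>x. cnj (emb_inv n x))"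
      by (intro continuous_intros continuous_on_emb_inv)
    then show "continuous_on (T n) h"
      by (rule continuous_on_eq) (simp add: h_def)
    show "continuous_on (X - V) h"
      by (rule continuous_on_eq[OF continuous_on_const[of _ 0]]) (use n in \<open>auto simp: h_def\<close>)
  qed
  have "closed (T n \<union> (X - V))" using closed_T cl by (rule closed_Un)
  moreover have "T n \<union> (X - V) \<subseteq> X" using sub[of n] by blast
  \<comment> \<open>With \<open>J\<close> empty nothing is collapsed: \<open>F\<close> only has to
    be continuous.\<close>
  ultimately have "\<exists>F. continuous_on X F \<and> (\<forall>x\<in>T n \<union> (X - V). F x = h x)"
    by (rule extend[OF _ _ ch, of "{}"]) (simp, metis)
  then obtain F where F: "continuous_on X F" "\<And>x. x \<in> T n \<union> (X - V) \<Longrightarrow> F x = h x"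
    by blast
  have "F \<notin> B"
  proof
    assume "F \<in> B"
    interpret R: function_algebra K "R_alg K" by (rule function_algebra_R)
    have "(\<lambda>z. F (emb n z)) \<in> R_alg K" using \<open>F \<in> B\<close> by (simp add: B_def)
    then have "cnj \<in> R_alg K"
      by (rule R.cong_on) (use F(2) in \<open>simp add: T_eq h_def\<close>)
    with nontrivial show False ..
  qed
  moreover have "F y = 0" if "y \<in> X - V" for y
    using F(2)[of y] that n by (auto simp: h_def)
  ultimately show thesis by (rule that[OF F(1)])
qed

section \<open>Characters of \<open>B\<close>\<close>

text \<open>\<open>G\<close> is closed under conjugation and under inverses of functions without
  zeros. If the functions of \<open>G\<close> in the kernel had no common zero, compactness would
  give a finite sum of squared moduli that is invertible in \<open>G\<close> and still in the
  kernel.\<close>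

lemma character_on_G:
  assumes \<phi>: "character X B \<phi>"
  obtains x where "x \<in> X" "\<And>g. g \<in> G \<Longrightarrow> \<phi> g = g x"
proof -
  interpret function_algebra X B by (rule function_algebra_B)
  have GB: "g \<in> B" if "g \<in> G" for g using G_subset_B that by blast
  have Gconst: "(\<lambda>_. c) \<in> G" for c by (simp add: G_def)
  have "\<exists>x\<in>X. \<forall>g\<in>G. \<phi> g = 0 \<longrightarrow> g x = 0"
  proof (rule ccontr)
    assume "\<not> ?thesis"
    then obtain g where g: "\<And>x. x \<in> X \<Longrightarrow> g x \<in> G" "\<And>x. x \<in> X \<Longrightarrow> \<phi> (g x) = 0" "\<And>x. x \<in> X \<Longrightarrow> g x x \<noteq> 0"
      by metis
    have "\<exists>U. open U \<and> X \<inter> g x -` (- {0}) = X \<inter> U" if "x \<in> X" for x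
    proof -
      have "openin (top_of_set X) (X \<inter> g x -` (- {0}))"
        using g(1)[OF that] by (intro continuous_openin_preimage_gen) (auto simp: G_def)
      then show ?thesis by (auto simp: openin_open)
    qed
    then obtain U where U: "\<And>x. x \<in> X \<Longrightarrow> open (U x)" "\<And>x. x \<in> X \<Longrightarrow> X \<inter> g x -` (- {0}) = X \<inter> U x"
      by metis
    have "X \<subseteq> (\<Union>x\<in>X. U x)" using U(2) g(3) by blast
    then obtain I where I: "I \<subseteq> X" "finite I" "X \<subseteq> (\<Union>x\<in>I. U x)"
      using compactE_image[OF X, of X U] U(1) by blast
    define h where "h = (\<lambda>y. \<Sum>x\<in>I. g x y * cnj (g x y))"
    have hG: "h \<in> G"
    proof -
      have "continuous_on X (g x)" if "x \<in> I" for x using g(1) I that by (auto simp: G_def)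
      then have "continuous_on X h" unfolding h_def by (intro continuous_intros) auto
      moreover have "h y = h y'" if "y \<in> T n" "y' \<in> T n" for n y y'
        unfolding h_def
      proof (rule sum.cong)
        fix x assume "x \<in> I"
        then have "g x y = g x y'" using g(1) I that unfolding G_def by blast
        then show "g x y * cnj (g x y) = g x y' * cnj (g x y')" by simp
      qed simp
      ultimately show ?thesis unfolding G_def by blast
    qed
    have h0: "h y \<noteq> 0" if y: "y \<in> X" for y
    proof -
      have hy: "h y = of_real (\<Sum>x\<in>I. (norm (g x y))\<^sup>2)"
        unfolding h_def of_real_sum complex_norm_square ..
      obtain x where x: "x \<in> I" "y \<in> U x" using I y by blast
      then have "g x y \<noteq> 0" using U(2)[of x] I y by blast
      then have "0 < (\<Sum>x\<in>I. (norm (g x y))\<^sup>2)"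
        using I x by (intro sum_pos2[where i = x]) auto
      then show ?thesis unfolding hy of_real_eq_0_iff by linarith
    qed
    have iG: "(\<lambda>y. inverse (h y)) \<in> G"
    proof -
      have "continuous_on X (\<lambda>y. inverse (h y))"
        using hG h0 by (intro continuous_on_inverse) (auto simp: G_def)
      moreover have "inverse (h y) = inverse (h y')" if "y \<in> T n" "y' \<in> T n" for n y y'
      proof -
        have "h y = h y'" using hG that unfolding G_def by blast
        then show ?thesis by simp
      qed
      ultimately show ?thesis unfolding G_def by blast
    qed
    have cG: "(\<lambda>y. cnj (g x y)) \<in> G" if "x \<in> I" for x
    proof -
      have gx: "g x \<in> G" using g(1) I that by blast
      then have "continuous_on X (\<lambda>y. cnj (g x y))" unfolding G_def by (intro continuous_intros) auto
      moreover have "cnj (g x y) = cnj (g x y')" if "y \<in> T n" "y' \<in> T n" for n y y'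
      proof -
        have "g x y = g x y'" using gx that unfolding G_def by blast
        then show ?thesis by simp
      qed
      ultimately show ?thesis unfolding G_def by blast
    qed
    have "\<phi> h = (\<Sum>x\<in>I. \<phi> (\<lambda>y. g x y * cnj (g x y)))"
      unfolding h_def using g(1) I cG by (intro character_sum[OF \<phi>] mult GB) auto
    also have "\<dots> = 0"
    proof (intro sum.neutral ballI)
      fix x assume x: "x \<in> I"
      then have "g x \<in> B" "\<phi> (g x) = 0" using g I GB by auto
      then show "\<phi> (\<lambda>y. g x y * cnj (g x y)) = 0"
        using characterD(2)[OF \<phi> _ GB[OF cG[OF x]]] by simp
    qed
    finally have "\<phi> h = 0" .
    have "\<phi> (\<lambda>_. 1) = \<phi> (\<lambda>y. h y * inverse (h y))"
      by (rule characterD(4)[OF \<phi> const mult[OF GB[OF hG] GB[OF iG]]]) (simp add: h0)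
    also have "\<dots> = 0" using characterD(2)[OF \<phi> GB[OF hG] GB[OF iG]] \<open>\<phi> h = 0\<close> by simp
    finally show False using characterD(3)[OF \<phi>] by simp
  qed
  then obtain x where x: "x \<in> X" "\<And>g. g \<in> G \<Longrightarrow> \<phi> g = 0 \<Longrightarrow> g x = 0" by blast
  have "\<phi> g = g x" if g: "g \<in> G" for g
  proof -
    have "(\<lambda>y. g y - \<phi> g) \<in> G"
    proof -
      have "continuous_on X (\<lambda>y. g y - \<phi> g)" using g unfolding G_def by (intro continuous_intros) auto
      moreover have "g y - \<phi> g = g y' - \<phi> g" if "y \<in> T n" "y' \<in> T n" for n y y'
      proof -
        have "g y = g y'" using g that unfolding G_def by blast
        then show ?thesis by simp
      qed
      ultimately show ?thesis unfolding G_def by blast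
    qed
    moreover have "\<phi> (\<lambda>y. g y - \<phi> g) = 0"
      using character_diff[OF \<phi> GB[OF g] const] characterD(3)[OF \<phi>] by simp
    ultimately have "g x - \<phi> g = 0" by (rule x(2))
    then show ?thesis by simp
  qed
  with x(1) show thesis by (rule that)
qed

text \<open>A cutoff \<open>g\<close> in \<open>G\<close> that is 0 on \<open>S\<close> and 1 where
  \<open>norm (f y)\<close> is at least \<open>e\<close> satisfies
  \<open>\<phi> g = g x = 0\<close>. Hence \<open>\<phi> f = \<phi> (f - f * g)\<close>, whose
  modulus is at most \<open>e\<close>. The condition \<open>ST\<close> makes the prescribed values
  constant on every copy.\<close>

lemma character_vanishing:
  assumes \<phi>: "character X B \<phi>" and x: "x \<in> X" "\<And>g. g \<in> G \<Longrightarrow> \<phi> g = g x"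
    and S: "closed S" "S \<subseteq> X" "x \<in> S" and ST: "\<And>m. S \<inter> T m = {} \<or> S = T m"
    and f: "f \<in> B" "\<And>y. y \<in> S \<Longrightarrow> f y = 0"
  shows "\<phi> f = 0"
proof -
  interpret function_algebra X B by (rule function_algebra_B)
  have cf: "continuous_on X f" using f by (simp add: B_def)
  have "norm (\<phi> f) \<le> e" if e: "0 < e" for e
  proof -
    define V where "V = X \<inter> f -` {w. e \<le> norm w}"
    have "closed {w::complex. e \<le> norm w}" by (intro closed_Collect_le continuous_intros)
    then have V: "closed V"
      unfolding V_def by (rule continuous_closed_preimage[OF cf compact_imp_closed[OF X]])
    have VX: "V \<subseteq> X" by (auto simp: V_def)
    have VS: "y \<notin> V" if "y \<in> S" for y using f(2)[OF that] e by (simp add: V_def)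
    define h where "h = (\<lambda>y. if y \<in> S then 0 else 1 :: real)"
    have ch: "continuous_on (S \<union> V) h"
    proof (rule continuous_on_closed_Un[OF S(1) V])
      show "continuous_on S h"
        by (rule continuous_on_eq[OF continuous_on_const[of _ 0]]) (simp add: h_def)
      show "continuous_on V h"
        by (rule continuous_on_eq[OF continuous_on_const[of _ 1]]) (use VS in \<open>auto simp: h_def\<close>)
    qed
    have cl: "closed (S \<union> V)" "S \<union> V \<subseteq> X" using S V VX by auto
    have "h y = h y'" if "m \<in> UNIV" "y \<in> (S \<union> V) \<inter> T m" "y' \<in> (S \<union> V) \<inter> T m" for m y y'
      using ST[of m] that by (auto simp: h_def)
    moreover have "h ` (S \<union> V) \<subseteq> {0..1}" by (auto simp: h_def)
    ultimately obtain F :: "complex \<Rightarrow> real" where F: "continuous_on X F" "\<And>y. y \<in> S \<union> V \<Longrightarrow> F y = h y" "F ` X \<subseteq> {0..1}"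
      and FT: "\<And>m y y'. \<lbrakk>m \<in> UNIV; y \<in> T m; y' \<in> T m\<rbrakk> \<Longrightarrow> F y = F y'"
      using extend_real[OF cl ch _ zero_le_one, of UNIV] by blast
    have F01: "F y \<in> {0..1}" if "y \<in> X" for y using F(3) that by blast
    define g where "g = (\<lambda>y. complex_of_real (F y))"
    have gG: "g \<in> G"
    proof -
      have "continuous_on X g" unfolding g_def by (intro continuous_intros F)
      moreover have "g y = g y'" if "y \<in> T m" "y' \<in> T m" for m y y'
        using FT[OF UNIV_I that] by (simp add: g_def)
      ultimately show ?thesis unfolding G_def by blast
    qed
    then have gB: "g \<in> B" using G_subset_B by blast
    have "\<phi> g = 0" using x(2)[OF gG] F(2)[of x] S(3) by (simp add: g_def h_def)
    then have "\<phi> (\<lambda>y. f y * g y) = 0" using characterD(2)[OF \<phi> f(1) gB] by simp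
    then have "\<phi> f = \<phi> (\<lambda>y. f y - f y * g y)"
      using character_diff[OF \<phi> f(1) mult[OF f(1) gB]] by simp
    also have "norm \<dots> \<le> e"
    proof (rule character_bound[OF \<phi> diff[OF f(1) mult[OF f(1) gB]]])
      fix y assume y: "y \<in> X"
      have eq: "norm (f y - f y * g y) = norm (f y) * (1 - F y)"
      proof -
        have "f y - f y * g y = f y * of_real (1 - F y)" by (simp add: g_def algebra_simps)
        then show ?thesis using F01[OF y] by (simp add: norm_mult del: of_real_diff)
      qed
      show "norm (f y - f y * g y) \<le> e"
      proof (cases "y \<in> V")
        case True
        then have "F y = 1" using F(2)[of y] VS by (auto simp: h_def)
        then show ?thesis unfolding eq using e by simp
      next
        case False
        then have "norm (f y) \<le> e" using y by (simp add: V_def)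
        then have "norm (f y) * (1 - F y) \<le> e * 1" using F01[OF y] e by (intro mult_mono) auto
        then show ?thesis unfolding eq by simp
      qed
    qed
    finally show ?thesis .
  qed
  then have "norm (\<phi> f) \<le> 0" by (rule field_le_epsilon) simp
  then show ?thesis by simp
qed

text \<open>Let \<open>x\<close> be the point given by the restriction to \<open>G\<close>. Outside
  all copies, \<open>character_vanishing\<close> with \<open>S = {x}\<close> finishes. On
  \<open>T n\<close> it shows that \<open>\<phi> f\<close> depends only on the values of
  \<open>f\<close> on \<open>T n\<close>, so \<phi> induces a character of \<open>R_alg K\<close>,
  which is evaluation at a point of \<open>K\<close>.\<close>

lemma B_natural:
  assumes \<phi>: "character X B \<phi>"
  shows "\<exists>x\<in>X. \<forall>f\<in>B. \<phi> f = f x"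
proof -
  interpret function_algebra X B by (rule function_algebra_B)
  interpret R: function_algebra K "R_alg K" by (rule function_algebra_R)
  obtain x where x: "x \<in> X" "\<And>g. g \<in> G \<Longrightarrow> \<phi> g = g x"
    using character_on_G[OF \<phi>] by blast
  show ?thesis
  proof (cases "\<exists>n. x \<in> T n")
    case False
    have "\<phi> f = f x" if f: "f \<in> B" for f
    proof -
      have "\<phi> (\<lambda>y. f y - f x) = 0"
        by (rule character_vanishing[OF \<phi> x, of "{x}"]) (use x False f const in \<open>auto intro: diff\<close>)
      then show ?thesis
        using character_diff[OF \<phi> f const] characterD(3)[OF \<phi>] by simp
    qed
    with x(1) show ?thesis by blast
  next
    case True
    then obtain n where n: "x \<in> T n" by blast
    have vanish: "\<phi> f = 0" if "f \<in> B" "\<And>y. y \<in> T n \<Longrightarrow> f y = 0" for f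
    proof (rule character_vanishing[OF \<phi> x closed_T sub n _ that])
      show "T n \<inter> T m = {} \<or> T n = T m" for m using disj[of n m] by (cases "n = m") auto
    qed
    have agree: "\<phi> f = \<phi> g" if "f \<in> B" "g \<in> B" "\<And>z. z \<in> K \<Longrightarrow> f (emb n z) = g (emb n z)" for f g
    proof -
      have "\<phi> (\<lambda>y. f y - g y) = 0"
        by (rule vanish[OF diff[OF that(1,2)]]) (use that(3) in \<open>auto simp: T_eq\<close>)
      then show ?thesis using character_diff[OF \<phi> that(1,2)] by simp
    qed
    have "\<exists>F\<in>B. \<forall>z\<in>K. F (emb n z) = r z" if "r \<in> R_alg K" for r
      by (rule extend_R_alg[OF that, of "{}" n]) auto
    \<comment> \<open>The choice of extensions need not respect sums or products; by
      \<open>agree\<close> this does not affect the value of \<phi>.\<close>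
    then obtain E where E: "\<And>r. r \<in> R_alg K \<Longrightarrow> E r \<in> B"
      "\<And>r z. \<lbrakk>r \<in> R_alg K; z \<in> K\<rbrakk> \<Longrightarrow> E r (emb n z) = r z"
      by metis
    have "character K (R_alg K) (\<lambda>r. \<phi> (E r))"
      unfolding character_def
    proof (intro conjI ballI allI impI)
      fix f g assume fg: "f \<in> R_alg K" "g \<in> R_alg K"
      have "\<phi> (E (\<lambda>z. f z + g z)) = \<phi> (\<lambda>y. E f y + E g y)"
        by (rule agree) (use fg in \<open>auto intro!: E add R.add simp: E(2) R.add\<close>)
      then show "\<phi> (E (\<lambda>z. f z + g z)) = \<phi> (E f) + \<phi> (E g)"
        using characterD(1)[OF \<phi> E(1)[OF fg(1)] E(1)[OF fg(2)]] by simp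
      have "\<phi> (E (\<lambda>z. f z * g z)) = \<phi> (\<lambda>y. E f y * E g y)"
        by (rule agree) (use fg in \<open>auto intro!: E mult R.mult simp: E(2) R.mult\<close>)
      then show "\<phi> (E (\<lambda>z. f z * g z)) = \<phi> (E f) * \<phi> (E g)"
        using characterD(2)[OF \<phi> E(1)[OF fg(1)] E(1)[OF fg(2)]] by simp
      assume "\<forall>z\<in>K. f z = g z"
      then show "\<phi> (E f) = \<phi> (E g)"
        by (intro agree E fg) (use fg in \<open>auto simp: E(2)\<close>)
    next
      fix c
      have "\<phi> (E (\<lambda>_. c)) = \<phi> (\<lambda>_. c)"
        by (rule agree[OF E(1)[OF R.const] const]) (simp add: E(2)[OF R.const])
      then show "\<phi> (E (\<lambda>_. c)) = c" using characterD(3)[OF \<phi>] by simp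
    qed
    then obtain z where z: "z \<in> K" "\<And>r. r \<in> R_alg K \<Longrightarrow> \<phi> (E r) = r z"
      using character_R_alg[OF K(1)] by blast
    have "\<phi> f = f (emb n z)" if f: "f \<in> B" for f
    proof -
      have r: "(\<lambda>z. f (emb n z)) \<in> R_alg K" using f by (simp add: B_def)
      have "\<phi> f = \<phi> (E (\<lambda>z. f (emb n z)))"
        by (rule agree[OF f E(1)[OF r]]) (simp add: E(2)[OF r])
      then show ?thesis using z(2)[OF r] by simp
    qed
    moreover have "emb n z \<in> X" using z(1) sub[of n] by (auto simp: T_eq)
    ultimately show ?thesis by blast
  qed
qed

section \<open>The uniform algebra of extensional representatives\<close>

text \<open>Every function on \<open>X\<close> has exactly one representative here, as
  \<open>CX\<close> demands; \<open>B\<close> contains all total extensions of it.\<close>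

definition A :: "(complex \<Rightarrow> complex) set" where
  "A = B \<inter> extensional X"

abbreviation XT :: "complex topology" where "XT \<equiv> top_of_set X"

lemma CX_XT: "CX XT = {f. f \<in> extensional X \<and> continuous_on X f}"
proof -
  have "compactin XT (topspace XT)" using X by (simp add: compactin_subtopology)
  then show ?thesis by (subst compactin_mspace_cfunspace) auto
qed

lemma restrict_B: "f \<in> B \<Longrightarrow> restrict f X \<in> A"
proof -
  interpret function_algebra X B by (rule function_algebra_B)
  assume "f \<in> B"
  then have "restrict f X \<in> B" by (rule cong_on) simp
  then show ?thesis by (simp add: A_def)
qed

lemma A_subset_B: "A \<subseteq> B" by (simp add: A_def)

lemma A_regular_on: "regular_on XT A"
  unfolding regular_on_def
proof (intro allI impI)
  fix E x assume "closedin XT E \<and> x \<in> topspace XT - E"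
  then have E: "closed E" "E \<subseteq> X" "x \<in> X" "x \<notin> E"
    using closedin_closed_eq[OF compact_imp_closed[OF X]] by auto
  obtain F where F: "F \<in> B" "F x = 1" "\<And>y. y \<in> E \<Longrightarrow> F y = 0"
    by (rule B_regular[OF E]) blast
  show "\<exists>f\<in>A. f x = 1 \<and> f ` E \<subseteq> {0}"
  proof (intro bexI conjI)
    show "restrict F X \<in> A" by (rule restrict_B[OF F(1)])
    show "restrict F X x = 1" using E F by simp
    show "restrict F X ` E \<subseteq> {0}" using E(2) F(3) by (auto simp: restrict_def)
  qed
qed

lemma A_closed: "closedin (mtopology_of (CX_metric XT)) A"
proof -
  interpret function_algebra X B by (rule function_algebra_B)
  interpret M: Metric_space "CX XT" "mdist (CX_metric XT)" by (rule Metric_space_mspace_mdist)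
  have sub: "A \<subseteq> CX XT" unfolding CX_XT by (auto simp: A_def B_def)
  have cpt: "compactin XT (topspace XT)" using X by (simp add: compactin_subtopology)
  show ?thesis
    unfolding mtopology_of_def M.closedin_metric
  proof (intro conjI allI impI sub)
    fix f assume f: "f \<in> CX XT - A"
    show "\<exists>r>0. disjnt A (M.mball f r)"
    proof (rule ccontr)
      assume neg: "\<not> ?thesis"
      \<comment> \<open>If every ball around \<open>f\<close> meets \<open>A\<close>, then
        \<open>f\<close> is a uniform limit on \<open>X\<close> of elements of
        \<open>B\<close>.\<close>
      have "f \<in> B"
      proof (rule lim)
        fix e :: real assume "0 < e"
        then obtain g where g: "g \<in> A" "g \<in> M.mball f e" using neg by (auto simp: disjnt_iff)
        have fg: "f \<in> CX XT" "g \<in> CX XT" "mdist (CX_metric XT) f g < e"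
          using g(2) unfolding M.in_mball by blast+
        have "norm (f x - g x) < e" if "x \<in> X" for x
          using cfunspace_mdist_lt[OF cpt fg, of x] that by (simp add: dist_norm)
        then show "\<exists>g\<in>B. \<forall>x\<in>X. norm (f x - g x) < e" using g A_subset_B by blast
      qed
      moreover have "f \<in> extensional X" using f unfolding CX_XT by blast
      ultimately show False using f by (simp add: A_def)
    qed
  qed
qed

lemma fun_ops_A:
  shows "f \<in> A \<Longrightarrow> g \<in> A \<Longrightarrow> fun_add XT f g \<in> A"
    and "f \<in> A \<Longrightarrow> g \<in> A \<Longrightarrow> fun_mult XT f g \<in> A"
    and "f \<in> A \<Longrightarrow> fun_scale XT c f \<in> A"
    and "fun_const XT c \<in> A"
proof -
  interpret function_algebra X B by (rule function_algebra_B)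
  show "f \<in> A \<Longrightarrow> g \<in> A \<Longrightarrow> fun_add XT f g \<in> A"
    unfolding fun_add_def topspace_euclidean_subtopology using A_subset_B by (intro restrict_B add) auto
  show "f \<in> A \<Longrightarrow> g \<in> A \<Longrightarrow> fun_mult XT f g \<in> A"
    unfolding fun_mult_def topspace_euclidean_subtopology using A_subset_B by (intro restrict_B mult) auto
  show "f \<in> A \<Longrightarrow> fun_scale XT c f \<in> A"
    unfolding fun_scale_def topspace_euclidean_subtopology using A_subset_B by (intro restrict_B mult const) auto
  show "fun_const XT c \<in> A"
    unfolding fun_const_def topspace_euclidean_subtopology by (intro restrict_B const)
qed

lemma A_uniform_algebra: "uniform_algebra XT A"
  unfolding uniform_algebra_def
proof (intro conjI ballI allI impI fun_ops_A A_closed)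
  show "compact_space XT" using X by (simp add: compact_space_def compactin_subtopology)
  show "Hausdorff_space XT" by (simp add: Hausdorff_space_subtopology)
  show "A \<subseteq> CX XT" unfolding CX_XT by (auto simp: A_def B_def)
  fix x y assume xy: "x \<in> topspace XT" "y \<in> topspace XT" "x \<noteq> y"
  have "closedin XT {y}" using xy by (simp add: closedin_singleton)
  then obtain f where "f \<in> A" "f x = 1" "f ` {y} \<subseteq> {0}"
    using A_regular_on xy unfolding regular_on_def by blast
  then show "\<exists>f\<in>A. f x \<noteq> f y" by (intro bexI[of _ f]) auto
qed

lemma A_natural: "natural_algebra XT A"
  unfolding natural_algebra_def
proof (intro allI impI)
  interpret function_algebra X B by (rule function_algebra_B)
  fix \<phi> assume "mult_linear_functional XT A \<phi> \<and> (\<exists>f\<in>A. \<phi> f \<noteq> 0)"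
  then obtain f0 where \<phi>: "mult_linear_functional XT A \<phi>" and f0: "f0 \<in> A" "\<phi> f0 \<noteq> 0" by blast
  have res: "restrict f X = f" if "f \<in> A" for f
    using that by (simp add: A_def extensional_restrict)
  have "fun_mult XT f0 (fun_const XT 1) = restrict f0 X"
    by (auto simp: fun_mult_def fun_const_def restrict_def)
  \<comment> \<open>Comparing both sides at some \<open>f0\<close> with
    \<open>\<phi> f0 \<noteq> 0\<close> forces the value 1 on the unit, so \<phi> composed with
    restriction is a character of \<open>B\<close>.\<close>
  then have "\<phi> f0 = \<phi> f0 * \<phi> (fun_const XT 1)"
    using \<phi> f0 res fun_ops_A(4)[of 1] unfolding mult_linear_functional_def by metis
  then have one: "\<phi> (fun_const XT 1) = 1" using f0 by simp
  have "character X B (\<lambda>f. \<phi> (restrict f X))"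
    unfolding character_def
  proof (intro conjI ballI allI impI)
    fix f g assume fg: "f \<in> B" "g \<in> B"
    have eq: "restrict (\<lambda>x. f x + g x) X = fun_add XT (restrict f X) (restrict g X)"
      "restrict (\<lambda>x. f x * g x) X = fun_mult XT (restrict f X) (restrict g X)"
      by (auto simp: fun_add_def fun_mult_def restrict_def)
    show "\<phi> (restrict (\<lambda>x. f x + g x) X) = \<phi> (restrict f X) + \<phi> (restrict g X)"
      "\<phi> (restrict (\<lambda>x. f x * g x) X) = \<phi> (restrict f X) * \<phi> (restrict g X)"
      unfolding eq using \<phi> restrict_B[OF fg(1)] restrict_B[OF fg(2)]
      unfolding mult_linear_functional_def by blast+
    assume "\<forall>x\<in>X. f x = g x"
    then have "restrict f X = restrict g X" by (auto simp: restrict_def)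
    then show "\<phi> (restrict f X) = \<phi> (restrict g X)" by simp
  next
    fix c
    have "restrict (\<lambda>_. c) X = fun_scale XT c (fun_const XT 1)"
      by (auto simp: fun_scale_def fun_const_def restrict_def)
    then show "\<phi> (restrict (\<lambda>_. c) X) = c"
      using \<phi> fun_ops_A(4)[of 1] one unfolding mult_linear_functional_def by simp
  qed
  then obtain x where x: "x \<in> X" "\<forall>f\<in>B. \<phi> (restrict f X) = f x"
    using B_natural by blast
  have "\<phi> f = f x" if "f \<in> A" for f
    using x(2) that res[OF that] A_subset_B by force
  then show "\<exists>x\<in>topspace XT. \<forall>f\<in>A. \<phi> f = f x" using x(1) by auto
qed

text \<open>The complement of a closed proper subset \<open>F\<close> meets \<open>X\<close>, and
  \<open>B_essential\<close> yields a continuous function that vanishes on \<open>F\<close> and lies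
  outside the algebra.\<close>

lemma A_essential: "essential_algebra XT A"
  unfolding essential_algebra_def is_essential_set_def
proof (intro conjI allI impI)
  interpret function_algebra X B by (rule function_algebra_B)
  show "closedin XT (topspace XT)" by simp
  show "contains_vanishing_on XT A (topspace XT)"
    unfolding contains_vanishing_on_def CX_XT
  proof (intro ballI impI)
    fix f :: "complex \<Rightarrow> complex"
    assume f: "f \<in> {f. f \<in> extensional X \<and> continuous_on X f}" "\<forall>x\<in>topspace XT. f x = 0"
    have "f \<in> B" by (rule cong_on[OF const[of 0]]) (use f in auto)
    then show "f \<in> A" using f by (simp add: A_def)
  qed
  fix F assume F: "closedin XT F \<and> contains_vanishing_on XT A F"
  then have cF: "closed F" "F \<subseteq> X"
    using closedin_closed_eq[OF compact_imp_closed[OF X]] by auto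
  show "topspace XT \<subseteq> F"
  proof (rule ccontr)
    assume "\<not> topspace XT \<subseteq> F"
    then have "(- F) \<inter> X \<noteq> {}" by auto
    then obtain f where f: "continuous_on X f" "f \<notin> B" "\<And>y. y \<in> X - (- F) \<Longrightarrow> f y = 0"
      using B_essential[OF open_Compl[OF cF(1)]] by blast
    have "restrict f X \<in> CX XT"
      unfolding CX_XT using f(1) by (simp cong: continuous_on_cong)
    moreover have "\<forall>y\<in>F. restrict f X y = 0" using f(3) cF(2) by auto
    ultimately have "restrict f X \<in> B"
      using F A_subset_B unfolding contains_vanishing_on_def by blast
    then have "f \<in> B" by (rule cong_on) simp
    with f(2) show False ..
  qed
qed

end

theorem theorem1p2:
  shows "\<exists>A :: (complex \<Rightarrow> complex) set.
           uniform_algebra (top_of_set (cball 0 1)) A \<and>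
           essential_algebra (top_of_set (cball 0 1)) A \<and>
           natural_algebra (top_of_set (cball 0 1)) A \<and>
           regular_algebra (top_of_set (cball 0 1)) A"
proof -
  obtain K where K: "compact K" "K \<subseteq> cball 0 2" "interior K = {}" "cnj \<notin> R_alg K"
    and reg: "\<And>x C. \<lbrakk>x \<in> K; closed C; x \<notin> C\<rbrakk> \<Longrightarrow> \<exists>f\<in>R_alg K. f x = 1 \<and> (\<forall>z\<in>K \<inter> C. f z = 0)"
    using regular_swiss_cheese by blast
  obtain d :: "nat \<Rightarrow> complex \<times> real"
    where d: "\<And>n. 0 < snd (d n)" "\<And>n. snd (d n) \<le> inverse (real (Suc n))"
      "\<And>n. copy K (d n) \<subseteq> cball 0 1"
      "\<And>m n. m \<noteq> n \<Longrightarrow> copy K (d m) \<inter> copy K (d n) = {}"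
      "\<And>V. \<lbrakk>open V; V \<inter> cball 0 1 \<noteq> {}\<rbrakk> \<Longrightarrow> \<exists>n. copy K (d n) \<subseteq> V"
    using disjoint_copies[OF K(1-3)] by blast
  interpret swiss_cheese_copies K d "cball 0 1"
    by unfold_locales (fact compact_cball K reg d)+
  show ?thesis
    using A_uniform_algebra A_essential A_natural A_regular_on
    unfolding regular_algebra_def by blast
qed

end
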